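(* Out of the $79$ models under consideration, exactly $23$ are associated with a finite group $G(\mathcal S)$: (i) $16$ have a vertical symmetry (i.e. $\mathcal S$ is invariant under the reflection $(i,j)\mapsto(-i,j)$) and thus a group of order $4$; (ii) $5$ have a group of order $6$; (iii) $2$ have a group of order $8$. For the remaining $56$ models the group $G(\mathcal S)$ is infinite.
   Context: Let $\mathcal S\subset\{-1,0,1\}^2\setminus\{(0,0)\}$ be a set of "small" steps. The $79$ models under consideration are the step sets $\mathcal S$ satisfying all of the following: $\mathcal S$ contains a step with positive first coordinate, a step with negative first coordinate, a step with positive second coordinate and a step with negative second coordinate; $\mathcal S$ contains at least one step with both coordinates non-negative; $\mathcal S$ is not contained in $\{(-1,0),(0,1),(1,1),(-1,1),(-1,-1)\}$ (the steps weakly above the first diagonal) nor in $\{(0,-1),(1,0),(1,1),(1,-1),(-1,-1)\}$ (the steps weakly below it); and two step sets obtained from one another by the reflection $(i,j)\mapsto(j,i)$ are identified. (There are $138$ such sets, forming $79$ classes under this reflection.) For such $\mathcal S$, let $S(x,y)=\sum_{(i,j)\in\mathcal S}x^iy^j$, and write $S(x,y)=A_{-1}(x)\,y^{-1}+A_0(x)+A_1(x)\,y=B_{-1}(y)\,x^{-1}+B_0(y)+B_1(y)\,x$, where $A_{-1},A_1,B_{-1},B_1$ are nonzero Laurent polynomials. Define the birational involutions $\Phi:(x,y)\mapsto\left(\frac{1}{x}\,\frac{B_{-1}(y)}{B_1(y)},\,y\right)$ and $\Psi:(x,y)\mapsto\left(x,\,\frac{1}{y}\,\frac{A_{-1}(x)}{A_1(x)}\right)$,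 both of which leave $S(x,y)$ unchanged. The group $G(\mathcal S)$ is the group generated by $\Phi$ and $\Psi$ under composition; it is isomorphic to a dihedral group of order $2n$ with $n\in\mathbb N\cup\{\infty\}$, and it is finite of order $2n$ exactly when $\Psi\circ\Phi$ has finite order $n$. *)

theory Defs
  imports
    "HOL-Computational_Algebra.Computational_Algebra"
    "HOL-Computational_Algebra.Field_as_Ring"
    "HOL-Algebra.Generated_Groups"
begin

section \<open>Step sets\<close>

type_synonym step_set = "(int \<times> int) set"

definition small_steps :: step_set where
  "small_steps = ({-1, 0, 1} \<times> {-1, 0, 1}) - {(0, 0)}"

definition admissible :: "step_set \<Rightarrow> bool" where
  "admissible S \<longleftrightarrow>
     S \<subseteq> small_steps \<and>
     (\<exists>(i, j) \<in> S. i > 0) \<and> (\<exists>(i, j) \<in> S. i < 0) \<and>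
     (\<exists>(i, j) \<in> S. j > 0) \<and> (\<exists>(i, j) \<in> S. j < 0) \<and>
     (\<exists>(i, j) \<in> S. i \<ge> 0 \<and> j \<ge> 0) \<and>
     \<not> S \<subseteq> {(-1, 0), (0, 1), (1, 1), (-1, 1), (-1, -1)} \<and>
     \<not> S \<subseteq> {(0, -1), (1, 0), (1, 1), (1, -1), (-1, -1)}"

definition diagonal_reflection :: "(step_set \<times> step_set) set" where
  "diagonal_reflection =
     {(S, T). admissible S \<and> admissible T \<and> (T = S \<or> T = prod.swap ` S)}"

text \<open>A model is a class of step sets, with one or two members.\<close>

definition models :: "step_set set set" where
  "models = {S. admissible S} // diagonal_reflection"

definition vertical_symmetry :: "step_set \<Rightarrow> bool" where
  "vertical_symmetry S \<longleftrightarrow> (\<lambda>(i, j). (- i, j)) ` S = S"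

section \<open>Birational maps of the plane\<close>

text \<open>
  In \<^typ>\<open>complex poly poly\<close> the inner variable is \<open>x\<close> and the outer variable is \<open>y\<close>, so that
  the fraction field below is the field of rational functions in \<open>x\<close> and \<open>y\<close>.
\<close>

type_synonym ratfun = "complex poly poly fract"

definition const_rf :: "complex \<Rightarrow> ratfun" where
  "const_rf c = to_fract [:[:c:]:]"

definition x_rf :: ratfun where
  "x_rf = to_fract [:[:0, 1:]:]"

definition y_rf :: ratfun where
  "y_rf = to_fract [:0, 1:]"

text \<open>A rational map \<open>(x, y) \<mapsto> (f(x, y), g(x, y))\<close> is given by the pair \<open>(f, g)\<close>.\<close>

type_synonym ratmap = "ratfun \<times> ratfun"

definition poly_subst :: "ratmap \<Rightarrow> complex poly poly \<Rightarrow> ratfun" where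
  "poly_subst m p = poly (map_poly (\<lambda>a. poly (map_poly const_rf a) (fst m)) p) (snd m)"

text \<open>
  Substitution into a rational function may hit a vanishing denominator, and then returns the
  value \<open>0\<close>. This does not happen if \<open>m\<close> is dominant.
\<close>

definition rf_subst :: "ratmap \<Rightarrow> ratfun \<Rightarrow> ratfun" where
  "rf_subst m h = poly_subst m (fst (quot_of_fract h)) / poly_subst m (snd (quot_of_fract h))"

definition rm_comp :: "ratmap \<Rightarrow> ratmap \<Rightarrow> ratmap" where
  "rm_comp m m' = (rf_subst m' (fst m), rf_subst m' (snd m))"

definition rm_id :: ratmap where
  "rm_id = (x_rf, y_rf)"

text \<open>The two components have to be algebraically independent.\<close>

definition dominant :: "ratmap \<Rightarrow> bool" where
  "dominant m \<longleftrightarrow> (\<forall>p. p \<noteq> 0 \<longrightarrow> poly_subst m p \<noteq> 0)"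

definition birational :: "ratmap \<Rightarrow> bool" where
  "birational m \<longleftrightarrow>
     dominant m \<and> (\<exists>m'. dominant m' \<and> rm_comp m m' = rm_id \<and> rm_comp m' m = rm_id)"

definition Bir :: "ratmap monoid" where
  "Bir = \<lparr>carrier = {m. birational m}, mult = rm_comp, one = rm_id\<rparr>"

section \<open>The group of a step set\<close>

definition step_gf :: "step_set \<Rightarrow> ratfun" where
  "step_gf S = (\<Sum>(i, j)\<in>S. x_rf powi i * y_rf powi j)"

definition A_coeff :: "step_set \<Rightarrow> int \<Rightarrow> ratfun" where
  "A_coeff S j = (\<Sum>i | (i, j) \<in> S. x_rf powi i)"

definition B_coeff :: "step_set \<Rightarrow> int \<Rightarrow> ratfun" where
  "B_coeff S i = (\<Sum>j | (i, j) \<in> S. y_rf powi j)"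

definition Phi :: "step_set \<Rightarrow> ratmap" where
  "Phi S = (1 / x_rf * (B_coeff S (-1) / B_coeff S 1), y_rf)"

definition Psi :: "step_set \<Rightarrow> ratmap" where
  "Psi S = (x_rf, 1 / y_rf * (A_coeff S (-1) / A_coeff S 1))"

definition walk_group :: "step_set \<Rightarrow> ratmap monoid" where
  "walk_group S = subgroup_generated Bir {Phi S, Psi S}"

lemma step_gf_A:
  assumes "S \<subseteq> small_steps"
  shows "step_gf S = A_coeff S (-1) * y_rf powi (-1) + A_coeff S 0 + A_coeff S 1 * y_rf"
proof -
  have fin: "finite S"
    using assms by (rule finite_subset) (simp add: small_steps_def)
  have S: "S = prod.swap ` (SIGMA j:{-1, 0, 1}. {i. (i, j) \<in> S})"
    using assms by (fastforce simp: small_steps_def image_iff)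
  have fin': "finite {i. (i, j) \<in> S}" for j
    by (rule finite_subset[of _ "fst ` S"]) (use fin in \<open>force+\<close>)
  have "step_gf S = (\<Sum>(j, i)\<in>(SIGMA j:{-1, 0, 1}. {i. (i, j) \<in> S}). x_rf powi i * y_rf powi j)"
    unfolding step_gf_def by (subst S, subst sum.reindex) (auto simp: case_prod_unfold)
  also have "\<dots> = (\<Sum>j\<in>{-1, 0, 1}. A_coeff S j * y_rf powi j)"
    by (subst sum.Sigma[symmetric]) (auto simp: fin' A_coeff_def sum_distrib_right)
  finally show ?thesis by (simp add: add.assoc)
qed

lemma step_gf_B:
  assumes "S \<subseteq> small_steps"
  shows "step_gf S = B_coeff S (-1) * x_rf powi (-1) + B_coeff S 0 + B_coeff S 1 * x_rf"
proof -
  have fin: "finite S"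
    using assms by (rule finite_subset) (simp add: small_steps_def)
  have S: "S = (SIGMA i:{-1, 0, 1}. {j. (i, j) \<in> S})"
    using assms by (fastforce simp: small_steps_def)
  have fin': "finite {j. (i, j) \<in> S}" for i
    by (rule finite_subset[of _ "snd ` S"]) (use fin in \<open>force+\<close>)
  have "step_gf S = (\<Sum>(i, j)\<in>(SIGMA i:{-1, 0, 1}. {j. (i, j) \<in> S}). x_rf powi i * y_rf powi j)"
    unfolding step_gf_def using S by simp
  also have "\<dots> = (\<Sum>i\<in>{-1, 0, 1}. B_coeff S i * x_rf powi i)"
    by (subst sum.Sigma[symmetric]) (auto simp: fin' B_coeff_def sum_distrib_left mult.commute)
  finally show ?thesis by (simp add: add.assoc)
qed

lemma const_rf_0 [simp]: "const_rf 0 = 0"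
  by (simp add: const_rf_def)

lemma const_rf_1 [simp]: "const_rf 1 = 1"
  by (simp add: const_rf_def flip: one_pCons)

lemma poly_subst_id: "poly_subst rm_id p = to_fract p"
proof -
  have inner: "poly (map_poly const_rf a) x_rf = to_fract [:a:]" for a
    by (induction a) (simp_all add: map_poly_pCons const_rf_def x_rf_def
        flip: to_fract_add to_fract_mult)
  show ?thesis
    unfolding poly_subst_def rm_id_def fst_conv snd_conv inner
    by (induction p) (simp_all add: map_poly_pCons y_rf_def flip: to_fract_add to_fract_mult)
qed

lemma rf_subst_x: "rf_subst m x_rf = fst m"
  by (simp add: rf_subst_def poly_subst_def x_rf_def map_poly_pCons)

lemma rf_subst_y: "rf_subst m y_rf = snd m"
  by (simp add: rf_subst_def poly_subst_def y_rf_def map_poly_pCons)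

end

theory Submission
  imports Defs "HOL-Algebra.Multiplicative_Group"
begin

text \<open>
  \<open>G(S)\<close> is generated by two distinct involutions, so its order is twice the order of
  \<open>\<Theta> = \<Psi> \<circ> \<Phi>\<close>. If \<open>S\<close> has a vertical symmetry then \<open>\<Phi>\<close> is \<open>(1/x, y)\<close> and commutes with
  \<open>\<Psi>\<close>; in the seven other finite cases \<open>B_{-1} = y^b B_1\<close> and \<open>A_{-1} = x^c A_1\<close> with
  \<open>bc = 1\<close> or \<open>bc = 2\<close>, the generators are monomial maps and \<open>\<Theta>\<close> has order 3 or 4.

  In each of the remaining 56 models there is a number \<open>t\<close> such that some iterate of \<open>\<Theta>\<close> (the
  second to fifth) is the identity on the invariant curve \<open>S(x, y) = t\<close>. At a point of this curve
  the derivative \<open>M\<close> of that iterate is unipotent, and it turns out not to be the identity. Then no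
  power of \<open>M\<close> is the identity, so \<open>\<Theta>\<close> has infinite order. The point can be chosen with one
  rational coordinate and one quadratic coordinate, which reduces the verification to arithmetic in
  \<open>\<rat>(\<surd>d)\<close>.
\<close>

section \<open>Substitution homomorphisms\<close>

text \<open>Unipotence comes from the invariance of \<open>S(x, y)\<close>. The iterate fixes the
  curve pointwise, so M fixes its tangent direction; it preserves \<open>S(x, y)\<close>, so M
  preserves the differential dS. Where dS is nonzero both eigenvalues are therefore 1, and M v - v
  lies on the tangent line. With a = M v - v and M a = a one gets M^n v = v + n a, which never
  returns to v in characteristic 0. This only explains how the certificates arise; what gets checked
  is that an orbit of a point and a tangent vector closes up. The obstacle is that iterates of
  \<Theta> are elements of a fraction field, too large to expand, and have no value where a
  denominator vanishes. They are therefore expanded along formal curves, by a relation; an orbit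
  that meets no pole carries the expansion from one iterate to the next. Expansion along constant
  curves also yields dominance and the inequalities between rational functions. A further point: a
  vertical symmetry may be present in only one member of a class. Conjugation by the exchange of
  \<open>x\<close> and \<open>y\<close> makes the order of the group an invariant of the
  class.\<close>

definition eval2 :: "(complex \<Rightarrow> 'b::comm_ring_1) \<Rightarrow> 'b \<Rightarrow> 'b \<Rightarrow> complex poly poly \<Rightarrow> 'b" where
  "eval2 h X Y p = poly (map_poly (\<lambda>a. poly (map_poly h a) X) p) Y"

text \<open>Instances are \<open>const_rf\<close>, \<open>fps_const\<close> and the identity of the
  complex numbers, so that one notion of substitution serves for composing maps, for expanding along
  a curve and for evaluating at a point.\<close>

locale const_hom =
  fixes h :: "complex \<Rightarrow> 'b::comm_ring_1"
  assumes hom_0 [simp]: "h 0 = 0" and hom_1 [simp]: "h 1 = 1"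
    and hom_add: "h (a + b) = h a + h b" and hom_mult: "h (a * b) = h a * h b"
begin

lemma map_poly_add: "map_poly h (p + q) = map_poly h p + map_poly h q"
  by (rule poly_eqI) (simp add: coeff_map_poly hom_add)

lemma map_poly_mult: "map_poly h (p * q) = map_poly h p * map_poly h q"
proof (induction p)
  case (pCons a p)
  have "map_poly h (Polynomial.smult a q) = Polynomial.smult (h a) (map_poly h q)"
    by (rule poly_eqI) (simp add: coeff_map_poly hom_mult)
  then show ?case
    using pCons by (simp add: map_poly_add map_poly_pCons)
qed simp

lemma eval2_0 [simp]: "eval2 h X Y 0 = 0"
  by (simp add: eval2_def)

lemma eval2_pCons [simp]: "eval2 h X Y (pCons a p) = poly (map_poly h a) X + Y * eval2 h X Y p"
  by (simp add: eval2_def map_poly_pCons)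

lemma eval2_1 [simp]: "eval2 h X Y 1 = 1"
  by (simp add: one_pCons map_poly_pCons)

lemma eval2_add: "eval2 h X Y (p + q) = eval2 h X Y p + eval2 h X Y q"
proof -
  let ?k = "\<lambda>a. poly (map_poly h a) X"
  have "map_poly ?k (p + q) = map_poly ?k p + map_poly ?k q"
    by (rule poly_eqI) (simp add: coeff_map_poly map_poly_add)
  then show ?thesis
    by (simp add: eval2_def)
qed

lemma eval2_smult: "eval2 h X Y (Polynomial.smult a p) = poly (map_poly h a) X * eval2 h X Y p"
  by (induction p) (simp_all add: map_poly_mult algebra_simps)

lemma eval2_mult: "eval2 h X Y (p * q) = eval2 h X Y p * eval2 h X Y q"
  by (induction p) (simp_all add: eval2_add eval2_smult algebra_simps)

end

text \<open>Universal property of the polynomial ring: a map respecting sums, products and constants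
  is determined on polynomials by the images of the two variables.\<close>

lemma eval2_hom_comp:
  assumes "const_hom h" "const_hom h'" "f 0 = 0" "\<And>c. f (h c) = h' c"
    and "\<And>a b. f (a + b) = f a + f b" "\<And>a b. f (a * b) = f a * f b"
  shows "f (eval2 h X Y p) = eval2 h' (f X) (f Y) p"
proof -
  interpret h: const_hom h by fact
  interpret h': const_hom h' by fact
  have *: "f (poly (map_poly h a) X) = poly (map_poly h' a) (f X)" for a
    by (induction a) (simp_all add: assms map_poly_pCons)
  show ?thesis
    by (induction p) (simp_all add: assms * h.eval2_pCons h'.eval2_pCons)
qed

interpretation const_rf: const_hom const_rf
  proof
  show "const_rf (a + b) = const_rf a + const_rf b" for a b
    by (simp add: const_rf_def flip: to_fract_add)
  show "const_rf (a * b) = const_rf a * const_rf b" for a b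
    by (simp add: const_rf_def flip: to_fract_mult)
qed simp_all

interpretation fps_const: const_hom fps_const
  by unfold_locales simp_all

lemma poly_subst_eval2: "poly_subst m p = eval2 const_rf (fst m) (snd m) p"
  by (simp add: poly_subst_def eval2_def)

lemma ratfun_cases:
  obtains p q where "q \<noteq> 0" "(f :: ratfun) = to_fract p / to_fract q"
  by (metis Fract_conv_to_fract Fract_quot_of_fract snd_quot_of_fract_nonzero)

context
  fixes m assumes dom: "dominant m"
begin

lemma poly_subst_eq_0_iff: "poly_subst m p = 0 \<longleftrightarrow> p = 0"
  using dom unfolding dominant_def by (auto simp: poly_subst_def)

text \<open>\<open>rf_subst\<close> is defined through the reduced fraction. Cross-multiplying two
  representations and substituting relates their values, and dominance keeps the denominators
  nonzero; all homomorphism laws below rest on this freedom of representation.\<close>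

lemma rf_subst_fract:
  assumes "q \<noteq> 0"
  shows "rf_subst m (to_fract p / to_fract q) = poly_subst m p / poly_subst m q"
proof -
  define f where "f = to_fract p / to_fract q"
  define r s where "r = fst (quot_of_fract f)" and "s = snd (quot_of_fract f)"
  have s: "s \<noteq> 0" by (simp add: s_def)
  have "to_fract r / to_fract s = to_fract p / to_fract q"
    by (metis Fract_conv_to_fract Fract_quot_of_fract r_def s_def f_def)
  then have "to_fract (r * q) = to_fract (p * s)"
    using assms s by (simp add: field_simps)
  then have "poly_subst m (r * q) = poly_subst m (p * s)"
    by (simp only: to_fract_eq_iff)
  then have "poly_subst m r / poly_subst m s = poly_subst m p / poly_subst m q"
    using assms s poly_subst_eq_0_iff
    by (simp add: poly_subst_eval2 const_rf.eval2_mult frac_eq_eq)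
  then show ?thesis
    by (simp add: rf_subst_def r_def s_def f_def)
qed

lemma rf_subst_to_fract: "rf_subst m (to_fract p) = poly_subst m p"
  using rf_subst_fract[of 1 p] by (simp add: poly_subst_eval2)

lemma rf_subst_0: "rf_subst m 0 = 0"
  using rf_subst_to_fract[of 0] by (simp add: poly_subst_eval2)

lemma rf_subst_1: "rf_subst m 1 = 1"
  using rf_subst_to_fract[of 1] by (simp add: poly_subst_eval2)

lemma rf_subst_mult: "rf_subst m (f * g) = rf_subst m f * rf_subst m g"
proof -
  obtain p q where 1: "q \<noteq> 0" "f = to_fract p / to_fract q" by (rule ratfun_cases)
  obtain r s where 2: "s \<noteq> 0" "g = to_fract r / to_fract s" by (rule ratfun_cases)
  have "f * g = to_fract (p * r) / to_fract (q * s)"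
    using 1 2 by simp
  then have "rf_subst m (f * g) = poly_subst m (p * r) / poly_subst m (q * s)"
    using 1 2 by (metis rf_subst_fract no_zero_divisors)
  then show ?thesis
    using 1 2 by (simp add: rf_subst_fract poly_subst_eval2 const_rf.eval2_mult)
qed

lemma rf_subst_add: "rf_subst m (f + g) = rf_subst m f + rf_subst m g"
proof -
  obtain p q where 1: "q \<noteq> 0" "f = to_fract p / to_fract q" by (rule ratfun_cases)
  obtain r s where 2: "s \<noteq> 0" "g = to_fract r / to_fract s" by (rule ratfun_cases)
  have "f + g = to_fract (p * s + r * q) / to_fract (q * s)"
    using 1 2 by (simp add: field_simps)
  then have *: "rf_subst m (f + g) = poly_subst m (p * s + r * q) / poly_subst m (q * s)"
    using 1 2 by (metis rf_subst_fract no_zero_divisors)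
  have "poly_subst m q \<noteq> 0" "poly_subst m s \<noteq> 0"
    using 1 2 poly_subst_eq_0_iff by auto
  then have "rf_subst m (f + g) = poly_subst m p / poly_subst m q + poly_subst m r / poly_subst m s"
    unfolding * by (simp add: poly_subst_eval2 const_rf.eval2_mult const_rf.eval2_add add_frac_eq)
  then show ?thesis
    using 1 2 by (simp add: rf_subst_fract)
qed

lemma rf_subst_eq_0_iff: "rf_subst m f = 0 \<longleftrightarrow> f = 0"
proof -
  obtain p q where 1: "q \<noteq> 0" "f = to_fract p / to_fract q" by (rule ratfun_cases)
  then show ?thesis
    by (simp add: rf_subst_fract poly_subst_eq_0_iff)
qed

lemma rf_subst_inverse: "rf_subst m (inverse f) = inverse (rf_subst m f)"
proof (cases "f = 0")
  case False
  then have "rf_subst m (inverse f) * rf_subst m f = 1"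
    by (simp flip: rf_subst_mult add: rf_subst_1)
  then show ?thesis
    by (simp add: inverse_unique[symmetric] mult.commute)
qed (simp add: rf_subst_0)

lemma rf_subst_divide: "rf_subst m (f / g) = rf_subst m f / rf_subst m g"
  by (simp add: divide_inverse rf_subst_mult rf_subst_inverse)

lemma rf_subst_power: "rf_subst m (f ^ n) = rf_subst m f ^ n"
  by (induction n) (simp_all add: rf_subst_1 rf_subst_mult)

lemma rf_subst_powi: "rf_subst m (f powi n) = rf_subst m f powi n"
  by (simp add: power_int_def rf_subst_power rf_subst_inverse)

lemma rf_subst_const: "rf_subst m (const_rf c) = const_rf c"
  unfolding const_rf_def rf_subst_to_fract by (simp add: poly_subst_eval2 map_poly_pCons const_rf_def)

lemma rf_subst_poly_subst: "rf_subst m (poly_subst m' p) = poly_subst (rm_comp m' m) p"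
  unfolding poly_subst_eval2 rm_comp_def fst_conv snd_conv
  by (rule eval2_hom_comp)
    (simp_all add: const_rf.const_hom_axioms rf_subst_0 rf_subst_add rf_subst_mult rf_subst_const)

lemma dominant_rm_comp: "dominant m' \<Longrightarrow> dominant (rm_comp m' m)"
  unfolding dominant_def rf_subst_poly_subst[symmetric] by (simp add: rf_subst_eq_0_iff)

text \<open>Pullback is contravariant, hence the reversed order. If a denominator vanishes under
  \<open>m'\<close>, it also vanishes under \<open>rm_comp m' m\<close>, and both sides are 0 by the
  convention for division.\<close>

lemma rf_subst_rf_subst: "rf_subst m (rf_subst m' f) = rf_subst (rm_comp m' m) f"
  by (simp add: rf_subst_def[of m'] rf_subst_def[of "rm_comp m' m"] rf_subst_divide rf_subst_poly_subst)

end

lemmas rf_subst_hom = rf_subst_x rf_subst_y rf_subst_0 rf_subst_1 rf_subst_mult rf_subst_add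
  rf_subst_inverse rf_subst_divide rf_subst_power rf_subst_powi

section \<open>The group of birational maps\<close>

lemma rm_comp_assoc:
  assumes "dominant m2" "dominant m3"
  shows "rm_comp (rm_comp m1 m2) m3 = rm_comp m1 (rm_comp m2 m3)"
  unfolding rm_comp_def[of "rm_comp m1 m2" m3] rm_comp_def[of m1 "rm_comp m2 m3"]
  by (simp add: rm_comp_def[of m1 m2] rf_subst_rf_subst[OF assms(2)])

lemma dominant_rm_id: "dominant rm_id"
  by (simp add: dominant_def poly_subst_id)

lemma rm_comp_id_left [simp]: "rm_comp rm_id m = m"
  by (simp add: rm_comp_def rm_id_def rf_subst_x rf_subst_y)

lemma rm_comp_id_right [simp]: "rm_comp m rm_id = m"
proof -
  have "rf_subst rm_id f = f" for f
    by (rule ratfun_cases[of f])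
      (simp add: rf_subst_fract[OF dominant_rm_id] poly_subst_id)
  then show ?thesis
    by (simp add: rm_comp_def)
qed

lemma group_Bir: "group Bir"
proof (rule groupI)
  fix m1 m2 assume m: "m1 \<in> carrier Bir" "m2 \<in> carrier Bir"
  then obtain n1 n2 where n: "dominant m1" "dominant m2" "dominant n1" "dominant n2"
    "rm_comp m1 n1 = rm_id" "rm_comp n1 m1 = rm_id" "rm_comp m2 n2 = rm_id" "rm_comp n2 m2 = rm_id"
    by (auto simp: Bir_def birational_def)
  have "rm_comp (rm_comp m1 m2) (rm_comp n2 n1) = rm_comp m1 (rm_comp (rm_comp m2 n2) n1)"
    using n(1-4) by (simp add: rm_comp_assoc dominant_rm_comp)
  also have "\<dots> = rm_id"
    using n by (simp only: rm_comp_id_left)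
  finally have "rm_comp (rm_comp m1 m2) (rm_comp n2 n1) = rm_id" .
  moreover have "rm_comp (rm_comp n2 n1) (rm_comp m1 m2) = rm_comp n2 (rm_comp (rm_comp n1 m1) m2)"
    using n(1-4) by (simp add: rm_comp_assoc dominant_rm_comp)
  then have "rm_comp (rm_comp n2 n1) (rm_comp m1 m2) = rm_id"
    using n by (simp only: rm_comp_id_left)
  ultimately have "birational (rm_comp m1 m2)"
    using n dominant_rm_comp unfolding birational_def by blast
  then show "m1 \<otimes>\<^bsub>Bir\<^esub> m2 \<in> carrier Bir"
    by (simp add: Bir_def)
next
  have "birational rm_id"
    unfolding birational_def using dominant_rm_id rm_comp_id_left by blast
  then show "\<one>\<^bsub>Bir\<^esub> \<in> carrier Bir"
    unfolding Bir_def by simp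
next
  fix m assume "m \<in> carrier Bir"
  then obtain n where "dominant m" "dominant n" "rm_comp m n = rm_id" "rm_comp n m = rm_id"
    by (auto simp: Bir_def birational_def)
  then have "birational n"
    unfolding birational_def by blast
  with \<open>rm_comp n m = rm_id\<close> show "\<exists>n\<in>carrier Bir. n \<otimes>\<^bsub>Bir\<^esub> m = \<one>\<^bsub>Bir\<^esub>"
    by (intro bexI[of _ n]) (simp_all add: Bir_def)
qed (auto simp: Bir_def birational_def rm_comp_assoc)

section \<open>Groups generated by two involutions\<close>

context group
begin

text \<open>The dihedral relation: a reflection inverts every rotation. Induction gives it for
  natural exponents.\<close>

lemma involution_conj_int_pow:
  assumes "a \<in> carrier G" "b \<in> carrier G" "a \<otimes> a = \<one>" "b \<otimes> b = \<one>"
  shows "a \<otimes> (a \<otimes> b) [^] (k::int) = inv ((a \<otimes> b) [^] k) \<otimes> a"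
proof -
  have [simp]: "inv a = a" "inv b = b"
    using assms by (simp_all add: inv_equality)
  have *: "a \<otimes> (a \<otimes> b) [^] n = inv ((a \<otimes> b) [^] n) \<otimes> a" for n :: nat
  proof (induction n)
    case (Suc n)
    have "a \<otimes> (a \<otimes> b) [^] Suc n = a \<otimes> (a \<otimes> b) [^] n \<otimes> (a \<otimes> b)"
      using assms by (simp add: m_assoc)
    also have "\<dots> = inv ((a \<otimes> b) [^] n) \<otimes> (a \<otimes> a) \<otimes> b"
      unfolding Suc using assms(1,2) by (simp only: m_assoc inv_closed nat_pow_closed m_closed)
    also have "\<dots> = inv ((a \<otimes> b) [^] n) \<otimes> b"
      using assms by simp
    also have "\<dots> = inv ((a \<otimes> b) [^] n) \<otimes> b \<otimes> (a \<otimes> a)"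
      using assms by simp
    also have "\<dots> = inv ((a \<otimes> b) [^] n) \<otimes> inv (a \<otimes> b) \<otimes> a"
      using assms(1,2) by (simp only: m_assoc inv_closed nat_pow_closed m_closed inv_mult_group
          \<open>inv a = a\<close> \<open>inv b = b\<close>)
    also have "inv ((a \<otimes> b) [^] n) \<otimes> inv (a \<otimes> b) = inv ((a \<otimes> b) [^] Suc n)"
      using assms by (metis inv_mult_group m_closed nat_pow_Suc2 nat_pow_closed)
    finally show ?case .
  qed (use assms in simp)
  show ?thesis
  proof (cases k rule: int_cases2)
    case (nonneg n)
    then show ?thesis
      by (simp only: int_pow_int *)
  next
    case (nonpos n)
    let ?x = "(a \<otimes> b) [^] n"
    have x: "?x \<in> carrier G"
      using assms(1,2) by simp
    \<comment> \<open>Inverting the identity for \<open>n\<close> and multiplying by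
      \<open>a\<close> on both sides turns it into the identity for \<open>- n\<close>.\<close>
    have "inv (a \<otimes> ?x) = inv (inv ?x \<otimes> a)"
      by (simp only: *)
    then have "inv ?x \<otimes> a = a \<otimes> ?x"
      using x assms(1) by (simp only: inv_mult_group inv_inv inv_closed \<open>inv a = a\<close>)
    then have "a \<otimes> (inv ?x \<otimes> a) \<otimes> a = a \<otimes> (a \<otimes> ?x) \<otimes> a"
      by (simp only:)
    then have "a \<otimes> inv ?x \<otimes> (a \<otimes> a) = (a \<otimes> a) \<otimes> ?x \<otimes> a"
      using x assms(1) by (simp only: m_assoc m_closed inv_closed)
    then have "a \<otimes> inv ?x = inv (inv ?x) \<otimes> a"
      using x assms(1,3) by (simp only: r_one l_one m_closed inv_closed inv_inv)
    then show ?thesis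
      using nonpos assms(1,2) by (simp only: int_pow_neg int_pow_int m_closed)
  qed
qed

text \<open>Rotations and reflections. By the dihedral relation, products and inverses of elements
  \<open>c^k\<close> and \<open>c^k a\<close> with \<open>c = a b\<close> have the same
  form.\<close>

lemma generate_involutions:
  assumes "a \<in> carrier G" "b \<in> carrier G" "a \<otimes> a = \<one>" "b \<otimes> b = \<one>"
  shows "generate G {a, b} = generate G {a \<otimes> b} \<union> (\<lambda>g. g \<otimes> a) ` generate G {a \<otimes> b}"
    (is "_ = ?C \<union> ?D")
proof (rule generateI[symmetric])
  let ?c = "a \<otimes> b"
  have [simp]: "inv a = a" "inv b = b"
    using assms by (simp_all add: inv_equality)
  have C: "?C = range (\<lambda>k::int. ?c [^] k)"
    using assms by (subst generate_pow) auto
  have inC: "?c [^] (k::int) \<in> ?C" for k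
    unfolding C by blast
  have conj: "a \<otimes> ?c [^] k = ?c [^] (- k) \<otimes> a" for k :: int
    using involution_conj_int_pow[OF assms] assms by (simp add: int_pow_neg)
  show "subgroup (?C \<union> ?D) G"
  proof (rule subgroupI)
    show "?C \<union> ?D \<subseteq> carrier G"
      using assms by (auto simp: C)
    show "?C \<union> ?D \<noteq> {}"
      by (auto intro: generate.one)
  next
    fix g assume "g \<in> ?C \<union> ?D"
    then consider k :: int where "g = ?c [^] k" | k :: int where "g = ?c [^] k \<otimes> a"
      by (auto simp: C)
    then show "inv g \<in> ?C \<union> ?D"
    proof cases
      case 1
      then show ?thesis
        using assms inC[of "- k"] by (simp add: int_pow_neg)
    next
      case 2
      then have "inv g = ?c [^] k \<otimes> a"
        using assms conj[of "- k"] by (simp add: inv_mult_group int_pow_neg)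
      then show ?thesis using inC by blast
    qed
  next
    fix g h assume "g \<in> ?C \<union> ?D" "h \<in> ?C \<union> ?D"
    then obtain k l :: int where "g = ?c [^] k \<or> g = ?c [^] k \<otimes> a" "h = ?c [^] l \<or> h = ?c [^] l \<otimes> a"
      by (auto simp: C)
    moreover have "?c [^] k \<otimes> ?c [^] l = ?c [^] (k + l)"
      using assms by (simp add: int_pow_mult)
    moreover have "?c [^] k \<otimes> (?c [^] l \<otimes> a) = ?c [^] (k + l) \<otimes> a"
      using assms by (simp add: int_pow_mult m_assoc)
    moreover have *: "(?c [^] k \<otimes> a) \<otimes> ?c [^] l = ?c [^] (k - l) \<otimes> a"
    proof -
      have "(?c [^] k \<otimes> a) \<otimes> ?c [^] l = ?c [^] k \<otimes> (?c [^] (- l) \<otimes> a)"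
        using assms conj[of l] by (simp add: m_assoc)
      also have "\<dots> = ?c [^] (k + (- l)) \<otimes> a"
        using assms by (simp only: int_pow_mult m_assoc m_closed int_pow_closed)
      finally show ?thesis by simp
    qed
    moreover have "(?c [^] k \<otimes> a) \<otimes> (?c [^] l \<otimes> a) = ?c [^] (k - l)"
    proof -
      have "(?c [^] k \<otimes> a) \<otimes> (?c [^] l \<otimes> a) = (?c [^] k \<otimes> a \<otimes> ?c [^] l) \<otimes> a"
        using assms by (simp add: m_assoc)
      also have "\<dots> = ?c [^] (k - l) \<otimes> (a \<otimes> a)"
        unfolding * using assms(1,2) by (simp only: m_assoc m_closed int_pow_closed)
      finally show ?thesis using assms by simp
    qed
    ultimately show "g \<otimes> h \<in> ?C \<union> ?D"
      using inC by auto
  qed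
  have "\<one> \<otimes> a \<in> ?D"
    using generate.one by blast
  \<comment> \<open>This element is \<open>b\<close>.\<close>
  moreover have "inv ?c \<otimes> a \<in> ?D"
    by (rule imageI) (simp add: generate.inv)
  ultimately show "{a, b} \<subseteq> ?C \<union> ?D"
    using assms by (simp add: inv_mult_group m_assoc)
next
  fix K assume K: "subgroup K G" "{a, b} \<subseteq> K"
  then have "a \<in> K" "b \<in> K"
    by simp_all
  then have "a \<otimes> b \<in> K"
    using subgroup.m_closed[OF K(1)] by simp
  then have C: "?C \<subseteq> K"
    using K(1) by (intro generate_subgroup_incl) simp_all
  moreover have "?D \<subseteq> K"
    using C \<open>a \<in> K\<close> subgroup.m_closed[OF K(1)] by (intro image_subsetI) (simp add: subset_iff)
  ultimately show "?C \<union> ?D \<subseteq> K"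
    by (rule Un_least)
qed

text \<open>The two cosets must be disjoint, that is, \<open>a\<close> must not be a power of
  \<open>c = a b\<close>. Otherwise \<open>a\<close> commutes with \<open>c\<close>, so
  \<open>c^2 = a^2 b^2 = 1\<close>, and \<open>a\<close> is either the identity or \<open>c\<close>;
  the latter forces \<open>b\<close> to be the identity. Since \<open>ord\<close> is 0 for elements
  of infinite order, the lower bound on \<open>ord\<close> also provides finiteness.\<close>

lemma card_generate_involutions:
  assumes "a \<in> carrier G" "b \<in> carrier G" "a \<otimes> a = \<one>" "b \<otimes> b = \<one>" "a \<noteq> \<one>" "b \<noteq> \<one>"
    and ord: "2 \<le> ord (a \<otimes> b)"
  shows "card (generate G {a, b}) = 2 * ord (a \<otimes> b)"
proof -
  let ?c = "a \<otimes> b" and ?C = "generate G {a \<otimes> b}"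
  have card: "card ?C = ord ?c"
    using generate_pow_card[of ?c] assms(1,2) by simp
  with ord have fin: "finite ?C"
    using card_ge_0_finite[of ?C] by linarith
  have sub: "subgroup ?C G"
    using assms by (intro generate_is_subgroup) simp
  have "a \<notin> ?C"
  proof
    assume "a \<in> ?C"
    then obtain k :: int where k: "a = ?c [^] k"
      using assms generate_pow[of ?c] by auto
    have "a \<otimes> ?c = ?c \<otimes> a"
    proof -
      have "?c [^] k \<otimes> ?c [^] (1::int) = ?c [^] (1::int) \<otimes> ?c [^] k"
        using assms(1,2) by (simp only: int_pow_mult[symmetric] m_closed add.commute)
      then show ?thesis
        using assms(1,2) by (simp only: k[symmetric] int_pow_1 m_closed)
    qed
    have "?c \<otimes> ?c = (?c \<otimes> a) \<otimes> b"
      using assms(1,2) by (simp only: m_assoc m_closed)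
    also have "\<dots> = (a \<otimes> a) \<otimes> (b \<otimes> b)"
      using assms(1,2) by (simp only: \<open>a \<otimes> ?c = ?c \<otimes> a\<close>[symmetric] m_assoc m_closed)
    finally have "?c [^] (2::nat) = \<one>"
      using assms(1-4) by (simp add: numeral_2_eq_2)
    then have "ord ?c dvd 2"
      using pow_eq_id assms(1,2) by blast
    then have "ord ?c = 2"
      using ord by (simp add: dvd_imp_le le_antisym)
    then have "?c [^] k = ?c [^] (k mod 2)"
    proof -
      have "2 dvd k mod 2 - k" by presburger
      with \<open>ord ?c = 2\<close> show ?thesis
        using assms(1,2) by (simp add: int_pow_eq)
    qed
    moreover have "k mod 2 = 0 \<or> k mod 2 = 1" by presburger
    ultimately have "a = \<one> \<or> a = ?c"
      using k assms(1,2) by (metis int_pow_0 int_pow_1 m_closed)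
    then show False
      using assms(1,2,5,6) by auto
  qed
  have "g \<otimes> a \<notin> ?C" if g: "g \<in> ?C" for g
  proof
    assume "g \<otimes> a \<in> ?C"
    then have "inv g \<otimes> (g \<otimes> a) \<in> ?C"
      using sub g by (simp add: subgroup.m_closed subgroup.m_inv_closed)
    moreover have "inv g \<otimes> (g \<otimes> a) = a"
      using assms(1) subgroup.mem_carrier[OF sub g] by (simp flip: m_assoc)
    ultimately show False
      using \<open>a \<notin> ?C\<close> by simp
  qed
  then have "?C \<inter> (\<lambda>g. g \<otimes> a) ` ?C = {}"
    by blast
  moreover have "card ((\<lambda>g. g \<otimes> a) ` ?C) = card ?C"
    by (rule card_image) (use assms sub in \<open>auto simp: inj_on_def subgroup.mem_carrier\<close>)
  ultimately show ?thesis
    unfolding generate_involutions[OF assms(1-4)]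
    using card card_Un_disjoint[OF fin finite_imageI[OF fin]] by simp
qed

lemma infinite_generate:
  assumes "S \<subseteq> carrier G" "c \<in> generate G S" "\<And>n. n > 0 \<Longrightarrow> c [^] (n::nat) \<noteq> \<one>"
  shows "infinite (generate G S)"
proof
  assume fin: "finite (generate G S)"
  have sub: "subgroup (generate G S) G"
    using assms(1) by (rule generate_is_subgroup)
  have c: "c \<in> carrier G"
    using sub assms(2) by (rule subgroup.mem_carrier)
  have "generate G {c} \<subseteq> generate G S"
    using assms(2) sub by (intro generate_subgroup_incl) auto
  then have "finite (generate G {c})"
    using fin by (rule finite_subset)
  moreover have "generate G {c} \<noteq> {}"
    using generate.one by blast
  ultimately have "ord c > 0"
    using generate_pow_card[OF c] by (simp add: card_gt_0_iff)
  then show False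
    using assms(3)[of "ord c"] pow_ord_eq_1[OF c] by blast
qed

end

section \<open>Evaluation along formal curves\<close>

text \<open>
  The expansion along the formal curve \<open>(X, Y)\<close> is a relation, since it does not exist when the
  denominator vanishes at the base point.
\<close>

definition fval :: "complex fps \<Rightarrow> complex fps \<Rightarrow> ratfun \<Rightarrow> complex fps \<Rightarrow> bool" where
  "fval X Y f F \<longleftrightarrow> (\<exists>p q. f = to_fract p / to_fract q \<and> eval2 fps_const X Y q $ 0 \<noteq> 0 \<and>
     eval2 fps_const X Y p = F * eval2 fps_const X Y q)"

lemma fvalI:
  assumes "f = to_fract p / to_fract q" "eval2 fps_const X Y q $ 0 \<noteq> 0"
    "eval2 fps_const X Y p = F * eval2 fps_const X Y q"
  shows "fval X Y f F"
  using assms unfolding fval_def by blast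

lemma fval_unique:
  assumes "fval X Y f F" "fval X Y f G"
  shows "F = G"
proof -
  let ?E = "eval2 fps_const X Y"
  obtain p q where 1: "f = to_fract p / to_fract q" "?E q $ 0 \<noteq> 0" "?E p = F * ?E q"
    using assms(1) unfolding fval_def by blast
  obtain r s where 2: "f = to_fract r / to_fract s" "?E s $ 0 \<noteq> 0" "?E r = G * ?E s"
    using assms(2) unfolding fval_def by blast
  have nz: "?E q \<noteq> 0" "?E s \<noteq> 0"
    using 1 2 by auto
  then have "q \<noteq> 0" "s \<noteq> 0"
    by auto
  then have "to_fract (p * s) = to_fract (r * q)"
    using 1(1) 2(1) by (simp add: frac_eq_eq)
  then have "p * s = r * q"
    by (simp only: to_fract_eq_iff)
  then have "?E p * ?E s = ?E r * ?E q"
    by (metis fps_const.eval2_mult)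
  then have "F * (?E q * ?E s) = G * (?E q * ?E s)"
    by (simp add: 1 2 ac_simps)
  then show ?thesis
    using nz by simp
qed

lemma fval_to_fract: "fval X Y (to_fract p) (eval2 fps_const X Y p)"
  unfolding fval_def by (rule exI[of _ p], rule exI[of _ 1]) simp

lemma fval_x: "fval X Y x_rf X"
  using fval_to_fract[of X Y "[:[:0, 1:]:]"] by (simp add: x_rf_def map_poly_pCons)

lemma fval_y: "fval X Y y_rf Y"
  using fval_to_fract[of X Y "[:0, 1:]"] by (simp add: y_rf_def map_poly_pCons)

lemma fval_const: "fval X Y (const_rf c) (fps_const c)"
  using fval_to_fract[of X Y "[:[:c:]:]"] by (simp add: const_rf_def map_poly_pCons)

lemma fval_add:
  assumes "fval X Y f F" "fval X Y g G"
  shows "fval X Y (f + g) (F + G)"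
proof -
  let ?E = "eval2 fps_const X Y"
  obtain p q where 1: "f = to_fract p / to_fract q" "?E q $ 0 \<noteq> 0" "?E p = F * ?E q"
    using assms(1) unfolding fval_def by blast
  obtain r s where 2: "g = to_fract r / to_fract s" "?E s $ 0 \<noteq> 0" "?E r = G * ?E s"
    using assms(2) unfolding fval_def by blast
  have "q \<noteq> 0" "s \<noteq> 0"
    using 1 2 by auto
  then have "f + g = to_fract (p * s + r * q) / to_fract (q * s)"
    using 1 2 by (simp add: add_frac_eq)
  then show ?thesis
    by (rule fvalI) (simp_all add: 1 2 fps_const.eval2_add fps_const.eval2_mult algebra_simps)
qed

lemma fval_mult:
  assumes "fval X Y f F" "fval X Y g G"
  shows "fval X Y (f * g) (F * G)"
proof -
  let ?E = "eval2 fps_const X Y"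
  obtain p q where 1: "f = to_fract p / to_fract q" "?E q $ 0 \<noteq> 0" "?E p = F * ?E q"
    using assms(1) unfolding fval_def by blast
  obtain r s where 2: "g = to_fract r / to_fract s" "?E s $ 0 \<noteq> 0" "?E r = G * ?E s"
    using assms(2) unfolding fval_def by blast
  have "f * g = to_fract (p * r) / to_fract (q * s)"
    using 1 2 by simp
  then show ?thesis
    by (rule fvalI) (simp_all add: 1 2 fps_const.eval2_mult algebra_simps)
qed

lemma fval_inverse:
  assumes "fval X Y f F" "F $ 0 \<noteq> 0"
  shows "fval X Y (inverse f) (inverse F)"
proof -
  let ?E = "eval2 fps_const X Y"
  obtain p q where 1: "f = to_fract p / to_fract q" "?E q $ 0 \<noteq> 0" "?E p = F * ?E q"
    using assms(1) unfolding fval_def by blast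
  have "?E q = inverse F * ?E p"
    using assms(2) 1(3) by (simp add: inverse_mult_eq_1 flip: mult.assoc)
  then show ?thesis
    using 1 assms(2) by (intro fvalI[of _ q p]) simp_all
qed

lemma fval_divide:
  assumes "fval X Y f F" "fval X Y g G" "G $ 0 \<noteq> 0"
  shows "fval X Y (f / g) (F * inverse G)"
  unfolding divide_inverse by (intro fval_mult fval_inverse assms)

text \<open>\<open>m\<close> carries the curve \<open>(X, Y)\<close> to \<open>(F, G)\<close>, so
  expanding a pullback along the first curve is expanding along the second.\<close>

lemma fval_poly_subst:
  assumes "fval X Y (fst m) F" "fval X Y (snd m) G"
  shows "fval X Y (poly_subst m p) (eval2 fps_const F G p)"
proof -
  have 0: "fval X Y 0 0"
    using fval_to_fract[of X Y 0] by simp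
  have *: "fval X Y (poly (map_poly const_rf a) (fst m)) (poly (map_poly fps_const a) F)" for a
    by (induction a) (auto simp: map_poly_pCons 0 intro!: fval_add fval_mult fval_const assms)
  show ?thesis
    unfolding poly_subst_eval2 by (induction p) (auto simp: 0 intro!: fval_add fval_mult * assms)
qed

section \<open>The two involutions\<close>

text \<open>The sort is weaker than \<open>field\<close> because the formula is used for rational
  functions, for numbers and for formal power series alike.\<close>

definition laurent :: "(int \<Rightarrow> bool) \<Rightarrow> 'a::{comm_ring_1, inverse} \<Rightarrow> 'a" where
  "laurent P z = of_bool (P (-1)) * inverse z + of_bool (P 0) + of_bool (P 1) * z"

text \<open>The operator \<open>z d/dz\<close> applied to \<open>laurent P\<close>; divided by
  \<open>laurent P\<close> it gives the logarithmic derivative.\<close>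

definition euler :: "(int \<Rightarrow> bool) \<Rightarrow> 'a::{comm_ring_1, inverse} \<Rightarrow> 'a" where
  "euler P z = of_bool (P 1) * z - of_bool (P (-1)) * inverse z"

definition col :: "step_set \<Rightarrow> int \<Rightarrow> int \<Rightarrow> bool" where
  "col S i = (\<lambda>j. (i, j) \<in> S)"

definition row :: "step_set \<Rightarrow> int \<Rightarrow> int \<Rightarrow> bool" where
  "row S j = (\<lambda>i. (i, j) \<in> S)"

definition four_sided :: "step_set \<Rightarrow> bool" where
  "four_sided S \<longleftrightarrow> S \<subseteq> small_steps \<and>
     (\<exists>j. col S (-1) j) \<and> (\<exists>j. col S 1 j) \<and> (\<exists>i. row S (-1) i) \<and> (\<exists>i. row S 1 i)"

lemma laurent_powi:
  fixes z :: "'a::field"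
  assumes "{i. P i} \<subseteq> {-1, 0, 1}"
  shows "(\<Sum>i | P i. z powi i) = laurent P z"
proof -
  have "{i. P i} = {i \<in> {-1, 0, 1}. P i}"
    using assms by blast
  then have "(\<Sum>i | P i. z powi i) = (\<Sum>i\<in>{-1, 0, 1}. if P i then z powi i else 0)"
    by (simp only:) (subst sum.inter_filter, simp_all)
  then show ?thesis
    by (simp add: laurent_def)
qed

lemma B_coeff_laurent: "S \<subseteq> small_steps \<Longrightarrow> B_coeff S i = laurent (col S i) y_rf"
  unfolding B_coeff_def by (subst laurent_powi[symmetric]) (auto simp: col_def small_steps_def)

lemma A_coeff_laurent: "S \<subseteq> small_steps \<Longrightarrow> A_coeff S j = laurent (row S j) x_rf"
  unfolding A_coeff_def by (subst laurent_powi[symmetric]) (auto simp: row_def small_steps_def)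

lemma four_sided_cases:
  assumes "four_sided S"
  shows "\<exists>j\<in>{-1, 0, 1}. col S (-1) j" "\<exists>j\<in>{-1, 0, 1}. col S 1 j"
    "\<exists>j\<in>{-1, 0, 1}. row S (-1) j" "\<exists>j\<in>{-1, 0, 1}. row S 1 j"
  using assms unfolding four_sided_def small_steps_def col_def row_def by blast+

lemma finite_laurent_zeros:
  assumes "\<exists>i\<in>{-1, 0, 1}. P i"
  shows "finite {z :: complex. laurent P z = 0}"
proof -
  let ?p = "[:of_bool (P (-1)), of_bool (P 0), of_bool (P 1):] :: complex poly"
  have "?p \<noteq> 0"
    using assms by auto
  \<comment> \<open>As \<open>inverse 0 = 0\<close>, the point 0 can be a zero of
    \<open>laurent P\<close> without being a root of the polynomial.\<close>
  then have "finite (insert 0 {z. poly ?p z = 0})"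
    using poly_roots_finite[of ?p] by (simp only: finite_insert not_False_eq_True)
  moreover have "{z. laurent P z = 0} \<subseteq> insert 0 {z. poly ?p z = 0}"
  proof
    fix z :: complex assume "z \<in> {z. laurent P z = 0}"
    then have 0: "laurent P z = 0"
      by simp
    show "z \<in> insert 0 {z. poly ?p z = 0}"
    proof (cases "z = 0")
      case False
      then have "poly ?p z = z * laurent P z"
        by (simp add: laurent_def algebra_simps)
      then show ?thesis
        unfolding 0 by simp
    qed simp
  qed
  ultimately show ?thesis
    by (rule finite_subset[rotated])
qed

lemma fval_laurent:
  assumes "fval X Y f F" "F $ 0 \<noteq> 0"
  shows "fval X Y (laurent P f) (laurent P F)"
proof -
  have "fval X Y (of_bool b) (of_bool b)" for b
    using fval_const[of X Y 0] fval_const[of X Y 1] by (cases b) auto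
  with assms show ?thesis
    unfolding laurent_def by (intro fval_add fval_mult fval_inverse)
qed

lemma laurent_fps_nth_0: "F $ 0 \<noteq> 0 \<Longrightarrow> laurent P F $ 0 = laurent P (F $ 0 :: complex)"
  by (simp add: laurent_def of_bool_def)

lemma fps_const_laurent:
  "fps_const (laurent P c) = laurent P (fps_const c :: complex fps)"
  by (simp add: laurent_def fps_const_inverse of_bool_def
      flip: fps_const_add fps_const_mult)

text \<open>At the point (1, 1) the Laurent polynomial counts the exponents in \<open>P\<close>,
  which is a positive number.\<close>

lemma laurent_nonzero:
  assumes "\<exists>i\<in>{-1, 0, 1}. P i" "f = x_rf \<or> f = y_rf"
  shows "laurent P f \<noteq> 0"
proof
  assume 0: "laurent P f = 0"
  have f: "fval 1 1 f 1"
    using assms(2) fval_x fval_y by auto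
  have "fval 1 1 0 0"
    using fval_to_fract[of 1 1 0] by simp
  then have "laurent P (1 :: complex fps) = 0"
    using fval_laurent[OF f, of P] fval_unique unfolding 0 by auto
  then have "laurent P (1 :: complex fps) $ 0 = 0"
    by simp
  then show False
    using assms(1) by (auto simp: laurent_fps_nth_0 laurent_def add_eq_0_iff of_bool_def split: if_splits)
qed

text \<open>Choosing \<open>a\<close> off the roots of the leading coefficient leaves a nonzero
  polynomial in the other variable, and both choices can avoid finite sets.\<close>

lemma poly_nonzero_point:
  fixes p :: "complex poly poly"
  assumes "p \<noteq> 0" "finite A" "finite B"
  obtains a b where "a \<notin> A" "b \<notin> B" "eval2 (\<lambda>c. c) a b p \<noteq> 0"
proof -
  have "finite (A \<union> {a. poly (lead_coeff p) a = 0})"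
    using assms by (simp add: poly_roots_finite)
  then obtain a where a: "a \<notin> A" "poly (lead_coeff p) a \<noteq> 0"
    using ex_new_if_finite[OF infinite_UNIV_char_0] by (metis (mono_tags, lifting) UnI1 UnI2 mem_Collect_eq)
  let ?q = "map_poly (\<lambda>c. poly c a) p"
  have "Polynomial.coeff ?q (degree p) \<noteq> 0"
    using a by (simp add: coeff_map_poly)
  then have "?q \<noteq> 0"
    by auto
  then have "finite (B \<union> {b. poly ?q b = 0})"
    using assms by (simp add: poly_roots_finite)
  then obtain b where b: "b \<notin> B" "poly ?q b \<noteq> 0"
    using ex_new_if_finite[OF infinite_UNIV_char_0] by (metis (mono_tags, lifting) UnI1 UnI2 mem_Collect_eq)
  have "eval2 (\<lambda>c. c) a b p = poly ?q b"
    by (simp add: eval2_def map_poly_idI)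
  with a b that show thesis
    by simp
qed

text \<open>A map whose values contain a product of two cofinite sets has Zariski-dense image. The
  value \<open>(a, b)\<close> may be attained along any curve, since only the constant expansion
  matters.\<close>

lemma dominantI:
  assumes "finite A" "finite B"
    and "\<And>a b. a \<notin> A \<Longrightarrow> b \<notin> B \<Longrightarrow>
      \<exists>X Y. fval X Y (fst m) (fps_const a) \<and> fval X Y (snd m) (fps_const b)"
  shows "dominant m"
  unfolding dominant_def
proof (intro allI impI notI)
  fix p :: "complex poly poly" assume "p \<noteq> 0" and 0: "poly_subst m p = 0"
  then obtain a b where ab: "a \<notin> A" "b \<notin> B" "eval2 (\<lambda>c. c) a b p \<noteq> 0"
    using poly_nonzero_point assms by blast
  then obtain X Y where "fval X Y (fst m) (fps_const a)" "fval X Y (snd m) (fps_const b)"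
    using assms by blast
  then have "fval X Y (poly_subst m p) (eval2 fps_const (fps_const a) (fps_const b) p)"
    by (rule fval_poly_subst)
  moreover have "fval X Y 0 0"
    using fval_to_fract[of X Y 0] by simp
  moreover have "const_hom (\<lambda>c::complex. c)"
    by unfold_locales simp_all
  then have "eval2 fps_const (fps_const a) (fps_const b) p = fps_const (eval2 (\<lambda>c. c) a b p)"
    by (subst eval2_hom_comp[where h' = fps_const]) (simp_all add: fps_const.const_hom_axioms)
  ultimately show False
    using ab 0 fval_unique by fastforce
qed

lemma rf_subst_laurent: "dominant m \<Longrightarrow> rf_subst m (laurent P f) = laurent P (rf_subst m f)"
  by (simp add: laurent_def rf_subst_hom of_bool_def)

section \<open>Dominance and involutivity of \<Phi> and \<Psi>\<close>

lemma Phi_eq: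
  assumes "four_sided S"
  shows "Phi S = (1 / x_rf * (laurent (col S (-1)) y_rf / laurent (col S 1) y_rf), y_rf)"
  using assms by (simp add: Phi_def B_coeff_laurent four_sided_def)

lemma Psi_eq:
  assumes "four_sided S"
  shows "Psi S = (x_rf, 1 / y_rf * (laurent (row S (-1)) x_rf / laurent (row S 1) x_rf))"
  using assms by (simp add: Psi_def A_coeff_laurent four_sided_def)

lemma Phi_comp:
  assumes "four_sided S" "dominant m"
  shows "rm_comp (Phi S) m =
    (1 / fst m * (laurent (col S (-1)) (snd m) / laurent (col S 1) (snd m)), snd m)"
  using assms by (simp add: rm_comp_def Phi_eq rf_subst_hom rf_subst_laurent)

lemma Psi_comp:
  assumes "four_sided S" "dominant m"
  shows "rm_comp (Psi S) m =
    (fst m, 1 / snd m * (laurent (row S (-1)) (fst m) / laurent (row S 1) (fst m)))"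
  using assms by (simp add: rm_comp_def Psi_eq rf_subst_hom rf_subst_laurent)

lemma fval_quotient:
  assumes "fval X Y f F" "fval X Y g G" "F $ 0 \<noteq> 0" "G $ 0 \<noteq> 0" "laurent Q (G $ 0) \<noteq> 0"
  shows "fval X Y (1 / f * (laurent P g / laurent Q g)) (inverse F * (laurent P G * inverse (laurent Q G)))"
  unfolding inverse_eq_divide[symmetric] using assms
  by (intro fval_mult fval_divide fval_inverse fval_laurent) (auto simp: laurent_fps_nth_0)

lemma dominant_Phi:
  assumes S: "four_sided S"
  shows "dominant (Phi S)"
proof (rule dominantI)
  show "finite {0::complex}"
    by simp
  show "finite ({b::complex. laurent (col S (-1)) b = 0} \<union> {b. laurent (col S 1) b = 0} \<union> {0})"
    using four_sided_cases[OF S] by (simp add: finite_laurent_zeros)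
  fix a b :: complex
  assume "a \<notin> {0}" "b \<notin> {b. laurent (col S (-1)) b = 0} \<union> {b. laurent (col S 1) b = 0} \<union> {0}"
  then have nz: "a \<noteq> 0" "b \<noteq> 0" "laurent (col S (-1)) b \<noteq> 0" "laurent (col S 1) b \<noteq> 0"
    by auto
  \<comment> \<open>A preimage of \<open>(a, b)\<close> under the involution \<Phi> is its own
    image, \<open>(c, b)\<close>.\<close>
  define c where "c = laurent (col S (-1)) b / laurent (col S 1) b / a"
  have "c \<noteq> 0" and a: "inverse c * (laurent (col S (-1)) b * inverse (laurent (col S 1) b)) = a"
    using nz by (simp_all add: c_def field_simps)
  have "fval (fps_const c) (fps_const b) (fst (Phi S)) (fps_const a)"
    using fval_quotient[OF fval_x[of "fps_const c" "fps_const b"] fval_y, of "col S 1" "col S (-1)"] nz \<open>c \<noteq> 0\<close>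
    unfolding Phi_eq[OF S] fst_conv a[symmetric]
    by (simp add: fps_const_laurent[symmetric] fps_const_inverse)
  then show "\<exists>X Y. fval X Y (fst (Phi S)) (fps_const a) \<and> fval X Y (snd (Phi S)) (fps_const b)"
    using fval_y by (auto simp: Phi_eq[OF S])
qed

lemma dominant_Psi:
  assumes S: "four_sided S"
  shows "dominant (Psi S)"
proof (rule dominantI)
  show "finite ({b::complex. laurent (row S (-1)) b = 0} \<union> {b. laurent (row S 1) b = 0} \<union> {0})"
    using four_sided_cases[OF S] by (simp add: finite_laurent_zeros)
  show "finite {0::complex}"
    by simp
  fix b a :: complex
  assume "b \<notin> {b. laurent (row S (-1)) b = 0} \<union> {b. laurent (row S 1) b = 0} \<union> {0}" "a \<notin> {0}"
  then have nz: "a \<noteq> 0" "b \<noteq> 0" "laurent (row S (-1)) b \<noteq> 0" "laurent (row S 1) b \<noteq> 0"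
    by auto
  define c where "c = laurent (row S (-1)) b / laurent (row S 1) b / a"
  have "c \<noteq> 0" and a: "inverse c * (laurent (row S (-1)) b * inverse (laurent (row S 1) b)) = a"
    using nz by (simp_all add: c_def field_simps)
  have "fval (fps_const b) (fps_const c) (snd (Psi S)) (fps_const a)"
    using fval_quotient[OF fval_y[of "fps_const b" "fps_const c"] fval_x, of "row S 1" "row S (-1)"] nz \<open>c \<noteq> 0\<close>
    unfolding Psi_eq[OF S] snd_conv a[symmetric]
    by (simp add: fps_const_laurent[symmetric] fps_const_inverse)
  then show "\<exists>X Y. fval X Y (fst (Psi S)) (fps_const b) \<and> fval X Y (snd (Psi S)) (fps_const a)"
    using fval_x by (auto simp: Psi_eq[OF S])
qed

lemma xy_nonzero [simp]: "x_rf \<noteq> 0" "y_rf \<noteq> 0"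
  by (simp_all add: x_rf_def y_rf_def)

lemma Phi_involution:
  assumes S: "four_sided S"
  shows "rm_comp (Phi S) (Phi S) = rm_id"
  using four_sided_cases[OF S] laurent_nonzero[of "col S (-1)" y_rf] laurent_nonzero[of "col S 1" y_rf]
  unfolding Phi_comp[OF S dominant_Phi[OF S]] by (simp add: Phi_eq[OF S] rm_id_def)

lemma Psi_involution:
  assumes S: "four_sided S"
  shows "rm_comp (Psi S) (Psi S) = rm_id"
  using four_sided_cases[OF S] laurent_nonzero[of "row S (-1)" x_rf] laurent_nonzero[of "row S 1" x_rf]
  unfolding Psi_comp[OF S dominant_Psi[OF S]] by (simp add: Psi_eq[OF S] rm_id_def)

section \<open>The group of a step set as a subgroup of \<open>Bir\<close>\<close>

lemma in_carrier_Bir: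
  assumes "four_sided S"
  shows "Phi S \<in> carrier Bir" "Psi S \<in> carrier Bir"
proof -
  have "birational (Phi S)" "birational (Psi S)"
    unfolding birational_def
    using dominant_Phi dominant_Psi Phi_involution Psi_involution assms by blast+
  then show "Phi S \<in> carrier Bir" "Psi S \<in> carrier Bir"
    by (simp_all add: Bir_def)
qed

lemma carrier_walk_group:
  assumes "four_sided S"
  shows "carrier (walk_group S) = generate Bir {Psi S, Phi S}"
  using in_carrier_Bir[OF assms]
  by (simp add: walk_group_def carrier_subgroup_generated Int_absorb1 insert_commute)

lemma Bir_simps [simp]: "mult Bir = rm_comp" "one Bir = rm_id"
  by (simp_all add: Bir_def)

lemma dominant_Bir: "m \<in> carrier Bir \<Longrightarrow> dominant m"
  by (simp add: Bir_def birational_def)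

section \<open>Models with a periodic point with unipotent derivative\<close>

text \<open>
  A state \<open>(x, y, u, w)\<close> is a point together with a tangent vector \<open>(x u, y w)\<close>. In these
  logarithmic coordinates the derivative of \<open>\<Phi>\<close> is the linear map
  \<open>(u, w) \<mapsto> (g(y) w - u, w)\<close>, where \<open>g\<close> is the logarithmic derivative of
  \<open>B_{-1}/B_1\<close> with respect to \<open>y d/dy\<close>.
\<close>

type_synonym 'a state = "'a \<times> 'a \<times> 'a \<times> 'a"

fun phi_step :: "step_set \<Rightarrow> complex state \<Rightarrow> complex state" where
  "phi_step S (x, y, u, w) =
     (inverse x * (laurent (col S (-1)) y * inverse (laurent (col S 1) y)), y,
      (euler (col S (-1)) y * inverse (laurent (col S (-1)) y) -
       euler (col S 1) y * inverse (laurent (col S 1) y)) * w - u, w)"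

fun psi_step :: "step_set \<Rightarrow> complex state \<Rightarrow> complex state" where
  "psi_step S (x, y, u, w) =
     (x, inverse y * (laurent (row S (-1)) x * inverse (laurent (row S 1) x)), u,
      (euler (row S (-1)) x * inverse (laurent (row S (-1)) x) -
       euler (row S 1) x * inverse (laurent (row S 1) x)) * u - w)"

fun phi_regular :: "step_set \<Rightarrow> complex state \<Rightarrow> bool" where
  "phi_regular S (x, y, u, w) \<longleftrightarrow>
     x \<noteq> 0 \<and> y \<noteq> 0 \<and> laurent (col S (-1)) y \<noteq> 0 \<and> laurent (col S 1) y \<noteq> 0"

fun psi_regular :: "step_set \<Rightarrow> complex state \<Rightarrow> bool" where
  "psi_regular S (x, y, u, w) \<longleftrightarrow>
     x \<noteq> 0 \<and> y \<noteq> 0 \<and> laurent (row S (-1)) x \<noteq> 0 \<and> laurent (row S 1) x \<noteq> 0"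

definition theta :: "step_set \<Rightarrow> complex state \<Rightarrow> complex state" where
  "theta S z = psi_step S (phi_step S z)"

definition theta_regular :: "step_set \<Rightarrow> complex state \<Rightarrow> bool" where
  "theta_regular S z \<longleftrightarrow> phi_regular S z \<and> psi_regular S (phi_step S z)"

text \<open>The linear coefficient is measured relative to the constant one, so that products of
  series add their tangent parts and inverses negate them.\<close>

definition jet :: "complex fps \<Rightarrow> complex \<Rightarrow> complex \<Rightarrow> bool" where
  "jet F a u \<longleftrightarrow> F $ 0 = a \<and> F $ 1 = a * u"

lemma jet_mult: "jet F a u \<Longrightarrow> jet G b w \<Longrightarrow> jet (F * G) (a * b) (u + w)"
  by (simp add: jet_def fps_mult_nth algebra_simps)

lemma jet_inverse:
  assumes "jet F a u" "a \<noteq> 0"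
  shows "jet (inverse F) (inverse a) (- u)"
proof -
  have "(inverse F * F) $ 1 = 0"
    using assms by (simp add: jet_def inverse_mult_eq_1)
  then have "inverse a * (a * u) + inverse F $ 1 * a = 0"
    using assms by (simp add: fps_mult_nth jet_def)
  then show ?thesis
    using assms by (simp add: jet_def field_simps add_eq_0_iff)
qed

lemma jet_laurent:
  assumes "jet F a u" "a \<noteq> 0" "laurent P a \<noteq> 0"
  shows "jet (laurent P F) (laurent P a) (euler P a * inverse (laurent P a) * u)"
proof -
  have i: "inverse F $ 0 = inverse a" "inverse F $ 1 = - (inverse a * u)"
    using jet_inverse[OF assms(1,2)] by (simp_all add: jet_def)
  have F: "F $ 0 = a" "F $ 1 = a * u"
    using assms(1) by (simp_all add: jet_def)
  have "laurent P F $ 1 = euler P a * u"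
    using i F by (simp add: laurent_def euler_def of_bool_def algebra_simps)
  moreover have "laurent P F $ 0 = laurent P a"
    using assms F by (simp add: laurent_fps_nth_0)
  ultimately show ?thesis
    using assms(3) by (simp add: jet_def)
qed

lemma jet_quotient:
  assumes "jet F a u" "jet G b w" "a \<noteq> 0" "b \<noteq> 0" "laurent P b \<noteq> 0" "laurent Q b \<noteq> 0"
  shows "jet (inverse F * (laurent P G * inverse (laurent Q G)))
    (inverse a * (laurent P b * inverse (laurent Q b)))
    ((euler P b * inverse (laurent P b) - euler Q b * inverse (laurent Q b)) * w - u)"
proof -
  have "jet (inverse F * (laurent P G * inverse (laurent Q G)))
    (inverse a * (laurent P b * inverse (laurent Q b)))
    (- u + (euler P b * inverse (laurent P b) * w + - (euler Q b * inverse (laurent Q b) * w)))"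
    by (intro jet_mult jet_inverse jet_laurent assms)
  then show ?thesis
    by (simp add: algebra_simps)
qed

text \<open>Stands in for the derivative of \<open>m\<close>: the map is defined along the formal
  curve, and the image curve has the given base point and logarithmic tangent vector.\<close>

fun passes :: "complex fps \<times> complex fps \<Rightarrow> ratmap \<Rightarrow> complex state \<Rightarrow> bool" where
  "passes (X, Y) m (x, y, u, w) \<longleftrightarrow>
     (\<exists>F G. fval X Y (fst m) F \<and> fval X Y (snd m) G \<and> jet F x u \<and> jet G y w)"

lemma passes_Phi:
  assumes "four_sided S" "dominant m" "passes C m z" "phi_regular S z"
  shows "passes C (rm_comp (Phi S) m) (phi_step S z)"
proof -
  obtain X Y where C: "C = (X, Y)" by fastforce
  obtain x y u w where z: "z = (x, y, u, w)" by (metis prod_cases4)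
  obtain F G where FG: "fval X Y (fst m) F" "fval X Y (snd m) G" "jet F x u" "jet G y w"
    using assms(3) unfolding C z by auto
  have nz: "x \<noteq> 0" "y \<noteq> 0" "laurent (col S (-1)) y \<noteq> 0" "laurent (col S 1) y \<noteq> 0"
    using assms(4) unfolding z by auto
  have "F $ 0 = x" "G $ 0 = y"
    using FG by (simp_all add: jet_def)
  then show ?thesis
    unfolding C z Phi_comp[OF assms(1,2)] passes.simps phi_step.simps fst_conv snd_conv
    using fval_quotient[OF FG(1,2), of "col S 1" "col S (-1)"] nz
      jet_quotient[OF FG(3,4) nz] FG(2,4) by blast
qed

lemma passes_Psi:
  assumes "four_sided S" "dominant m" "passes C m z" "psi_regular S z"
  shows "passes C (rm_comp (Psi S) m) (psi_step S z)"
proof -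
  obtain X Y where C: "C = (X, Y)" by fastforce
  obtain x y u w where z: "z = (x, y, u, w)" by (metis prod_cases4)
  obtain F G where FG: "fval X Y (fst m) F" "fval X Y (snd m) G" "jet F x u" "jet G y w"
    using assms(3) unfolding C z by auto
  have nz: "y \<noteq> 0" "x \<noteq> 0" "laurent (row S (-1)) x \<noteq> 0" "laurent (row S 1) x \<noteq> 0"
    using assms(4) unfolding z by auto
  have "F $ 0 = x" "G $ 0 = y"
    using FG by (simp_all add: jet_def)
  then show ?thesis
    unfolding C z Psi_comp[OF assms(1,2)] passes.simps psi_step.simps fst_conv snd_conv
    using fval_quotient[OF FG(2,1), of "row S 1" "row S (-1)"] nz
      jet_quotient[OF FG(4,3) nz] FG(1,3) by blast
qed

fun affine_comb :: "nat \<Rightarrow> complex state \<Rightarrow> complex state \<Rightarrow> complex state" where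
  "affine_comb n (x, y, u, w) (x', y', u', w') = (x, y, u + of_nat n * u', w + of_nat n * w')"

fun same_point :: "'a state \<Rightarrow> 'a state \<Rightarrow> bool" where
  "same_point (x, y, u, w) (x', y', u', w') \<longleftrightarrow> x = x' \<and> y = y'"

text \<open>Over a fixed base point the tangent part is transformed linearly, and regularity
  concerns the base point alone.\<close>

lemma theta_affine_comb:
  assumes "same_point z z'"
  shows "theta S (affine_comb n z z') = affine_comb n (theta S z) (theta S z')"
    "same_point (theta S z) (theta S z')"
    "theta_regular S (affine_comb n z z') = theta_regular S z"
  using assms by (cases z; cases z'; simp add: theta_def theta_regular_def algebra_simps)+

lemma funpow_theta_affine_comb:
  assumes "same_point z z'"
  shows "(theta S ^^ k) (affine_comb n z z') = affine_comb n ((theta S ^^ k) z) ((theta S ^^ k) z')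
    \<and> same_point ((theta S ^^ k) z) ((theta S ^^ k) z')"
  by (induction k) (simp_all add: assms theta_affine_comb)

text \<open>Going n times around the cycle sends the tangent vector \<open>(u, w)\<close> to
  \<open>(u, w) + n (a, b)\<close>, so no power of \<Theta> can be the identity.\<close>

lemma infinite_walk_group:
  assumes S: "four_sided S" and k: "k > 0"
    and reg: "\<And>i. i < k \<Longrightarrow> theta_regular S ((theta S ^^ i) (x, y, u, w))"
    and z: "(theta S ^^ k) (x, y, u, w) = (x, y, u + a, w + b)"
    and z': "(theta S ^^ k) (x, y, a, b) = (x, y, a, b)"
    and ab: "a \<noteq> 0 \<or> b \<noteq> 0"
  shows "infinite (carrier (walk_group S))"
proof -
  interpret Bir: group Bir by (rule group_Bir)
  note carr = in_carrier_Bir[OF S]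
  let ?c = "rm_comp (Psi S) (Phi S)"
  have cc: "?c \<in> carrier Bir"
    using Bir.m_closed[OF carr(2,1)] by simp
  \<comment> \<open>The simplest curve with the 1-jet \<open>(x, y, u, w)\<close>.\<close>
  define C where "C = (fps_const x + fps_const (x * u) * fps_X, fps_const y + fps_const (y * w) * fps_X)"
  let ?z = "(x, y, u, w)" and ?z' = "(x, y, a, b)"
  have xy: "x \<noteq> 0" "y \<noteq> 0"
    using reg[OF k, simplified] k by (auto simp: theta_regular_def dest: reg[of 0])
  have pass0: "passes C rm_id ?z"
    unfolding C_def rm_id_def passes.simps by (auto intro!: fval_x fval_y exI simp: jet_def)
  have step: "passes C (rm_comp ?c m) (theta S z)"
    if "m \<in> carrier Bir" "passes C m z" "theta_regular S z" for m z
  proof -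
    have dom: "dominant m" "dominant (rm_comp (Phi S) m)"
      using that(1) carr(1) Bir.m_closed dominant_Bir by fastforce+
    have "rm_comp ?c m = rm_comp (Psi S) (rm_comp (Phi S) m)"
      using dom dominant_Phi[OF S] by (simp add: rm_comp_assoc)
    then show ?thesis
      using that dom passes_Phi[OF S] passes_Psi[OF S]
      by (simp add: theta_def theta_regular_def)
  qed
  have block: "passes C (?c [^]\<^bsub>Bir\<^esub> (n + i)) ((theta S ^^ i) (affine_comb n' ?z ?z'))"
    if "passes C (?c [^]\<^bsub>Bir\<^esub> n) (affine_comb n' ?z ?z')" "i \<le> k" for n n' i :: nat
    using \<open>i \<le> k\<close>
  proof (induction i)
    case (Suc i)
    have sp: "same_point ((theta S ^^ i) ?z) ((theta S ^^ i) ?z')"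
      using funpow_theta_affine_comb[of ?z ?z' i S 0] by simp
    have eq: "(theta S ^^ i) (affine_comb n' ?z ?z') =
        affine_comb n' ((theta S ^^ i) ?z) ((theta S ^^ i) ?z')"
      using funpow_theta_affine_comb[of ?z ?z' i S n'] by simp
    \<comment> \<open>Regularity is known along the orbit of \<open>?z\<close> only; the combined
      state runs through the same base points.\<close>
    have "theta_regular S ((theta S ^^ i) (affine_comb n' ?z ?z'))"
      unfolding eq theta_affine_comb(3)[OF sp] using Suc.prems by (intro reg) simp
    moreover have "?c [^]\<^bsub>Bir\<^esub> (n + Suc i) = rm_comp ?c (?c [^]\<^bsub>Bir\<^esub> (n + i))"
      using Bir.nat_pow_Suc2[OF cc, of "n + i"] by simp
    ultimately show ?case
      using Suc step[OF Bir.nat_pow_closed[OF cc]] by simp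
  qed (use that in simp)
  have main: "passes C (?c [^]\<^bsub>Bir\<^esub> (k * n)) (affine_comb n ?z ?z')" for n
  proof (induction n)
    case 0
    then show ?case using pass0 by simp
  next
    case (Suc n)
    have "(theta S ^^ k) (affine_comb n ?z ?z') = affine_comb (Suc n) ?z ?z'"
      using funpow_theta_affine_comb[of ?z ?z' k S n] by (simp add: z z' algebra_simps)
    then show ?case
      using block[OF Suc, of k] by (simp add: add.commute)
  qed
  have "?c [^]\<^bsub>Bir\<^esub> n \<noteq> rm_id" if "n > 0" for n :: nat
  proof
    assume "?c [^]\<^bsub>Bir\<^esub> n = rm_id"
    \<comment> \<open>\<open>main\<close> speaks of whole periods only, hence the passage to an
      exponent divisible by \<open>k\<close>.\<close>
    then have "?c [^]\<^bsub>Bir\<^esub> (k * n) = rm_id"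
      using Bir.nat_pow_pow[OF cc, of n k] Bir.nat_pow_one[of k] by (simp add: mult.commute)
    then have "passes C rm_id (x, y, u + of_nat n * a, w + of_nat n * b)"
      using main[of n] by simp
    then have "u = u + of_nat n * a" "w = w + of_nat n * b"
      using pass0 fval_unique xy unfolding C_def passes.simps jet_def
      by (metis mult_cancel_left)+
    then show False
      using ab that by simp
  qed
  moreover have "?c \<in> generate Bir {Psi S, Phi S}"
    using generate.eng[of "Psi S" Bir _ "Phi S"] by (simp add: generate.incl)
  ultimately show ?thesis
    unfolding carrier_walk_group[OF S] using carr Bir.infinite_generate[of "{Psi S, Phi S}" ?c]
    by simp
qed

section \<open>Certificates over quadratic fields\<close>

type_synonym quad = "rat \<times> rat"

definition quad_val :: "complex \<Rightarrow> quad \<Rightarrow> complex" where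
  "quad_val r z = of_rat (fst z) + of_rat (snd z) * r"

definition quad_add :: "quad \<Rightarrow> quad \<Rightarrow> quad" where
  "quad_add z z' = (fst z + fst z', snd z + snd z')"

definition quad_diff :: "quad \<Rightarrow> quad \<Rightarrow> quad" where
  "quad_diff z z' = (fst z - fst z', snd z - snd z')"

definition quad_mult :: "rat \<Rightarrow> quad \<Rightarrow> quad \<Rightarrow> quad" where
  "quad_mult d z z' = (fst z * fst z' + d * (snd z * snd z'), fst z * snd z' + snd z * fst z')"

text \<open>A nonzero norm forces a nonzero value for every \<open>d\<close>, square or not, which
  is why all regularity tests are stated with norms.\<close>

definition quad_norm :: "rat \<Rightarrow> quad \<Rightarrow> rat" where
  "quad_norm d z = fst z * fst z - d * (snd z * snd z)"

definition quad_inverse :: "rat \<Rightarrow> quad \<Rightarrow> quad" where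
  "quad_inverse d z = (fst z / quad_norm d z, - (snd z / quad_norm d z))"

definition quad_if :: "bool \<Rightarrow> quad \<Rightarrow> quad" where
  "quad_if b z = (if b then z else (0, 0))"

definition quad_laurent :: "rat \<Rightarrow> (int \<Rightarrow> bool) \<Rightarrow> quad \<Rightarrow> quad" where
  "quad_laurent d P z =
     quad_add (quad_add (quad_if (P (-1)) (quad_inverse d z)) (quad_if (P 0) (1, 0))) (quad_if (P 1) z)"

definition quad_euler :: "rat \<Rightarrow> (int \<Rightarrow> bool) \<Rightarrow> quad \<Rightarrow> quad" where
  "quad_euler d P z = quad_diff (quad_if (P 1) z) (quad_if (P (-1)) (quad_inverse d z))"

definition quad_ratio :: "rat \<Rightarrow> (int \<Rightarrow> bool) \<Rightarrow> (int \<Rightarrow> bool) \<Rightarrow> quad \<Rightarrow> quad" where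
  "quad_ratio d P Q z = quad_mult d (quad_laurent d P z) (quad_inverse d (quad_laurent d Q z))"

definition quad_log_diff :: "rat \<Rightarrow> (int \<Rightarrow> bool) \<Rightarrow> quad \<Rightarrow> quad" where
  "quad_log_diff d P z = quad_mult d (quad_euler d P z) (quad_inverse d (quad_laurent d P z))"

definition quad_regular :: "rat \<Rightarrow> (int \<Rightarrow> bool) \<Rightarrow> (int \<Rightarrow> bool) \<Rightarrow> quad \<Rightarrow> quad \<Rightarrow> bool" where
  "quad_regular d P Q x y \<longleftrightarrow> quad_norm d x \<noteq> 0 \<and> quad_norm d y \<noteq> 0 \<and>
     quad_norm d (quad_laurent d P y) \<noteq> 0 \<and> quad_norm d (quad_laurent d Q y) \<noteq> 0"

text \<open>\<open>None\<close> reports a vanishing norm; a result \<open>Some\<close> thus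
  certifies that the step is regular.\<close>

fun quad_phi :: "rat \<Rightarrow> step_set \<Rightarrow> quad state \<Rightarrow> quad state option" where
  "quad_phi d S (x, y, u, w) = (if quad_regular d (col S (-1)) (col S 1) x y then
     Some (quad_mult d (quad_inverse d x) (quad_ratio d (col S (-1)) (col S 1) y), y,
       quad_diff (quad_mult d (quad_diff (quad_log_diff d (col S (-1)) y) (quad_log_diff d (col S 1) y)) w) u, w)
     else None)"

fun quad_psi :: "rat \<Rightarrow> step_set \<Rightarrow> quad state \<Rightarrow> quad state option" where
  "quad_psi d S (x, y, u, w) = (if quad_regular d (row S (-1)) (row S 1) y x then
     Some (x, quad_mult d (quad_inverse d y) (quad_ratio d (row S (-1)) (row S 1) x), u,
       quad_diff (quad_mult d (quad_diff (quad_log_diff d (row S (-1)) x) (quad_log_diff d (row S 1) x)) u) w)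
     else None)"

fun quad_orbit :: "rat \<Rightarrow> step_set \<Rightarrow> nat \<Rightarrow> quad state \<Rightarrow> quad state option" where
  "quad_orbit d S 0 z = Some z" |
  "quad_orbit d S (Suc n) z =
     Option.bind (Option.bind (quad_phi d S z) (quad_psi d S)) (quad_orbit d S n)"

text \<open>
  The orbit of the point \<open>(x, y)\<close> has period \<open>k\<close>, and the derivative \<open>M\<close> of the \<open>k\<close>-th iterate
  is unipotent but not the identity: \<open>a = M v - v\<close> is nonzero for \<open>v = (1, 1)\<close>, and \<open>M a = a\<close>.
\<close>

definition drift :: "rat \<Rightarrow> step_set \<Rightarrow> nat \<Rightarrow> quad \<Rightarrow> quad \<Rightarrow> quad state option" where
  "drift d S k x y = map_option
     (\<lambda>(x', y', u, w). (x', y', quad_diff u (1, 0), quad_diff w (1, 0))) (quad_orbit d S k (x, y, (1, 0), (1, 0)))"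

definition unipotent_cycle :: "rat \<Rightarrow> step_set \<Rightarrow> nat \<Rightarrow> quad \<Rightarrow> quad \<Rightarrow> bool" where
  "unipotent_cycle d S k x y \<longleftrightarrow> k > 0 \<and>
     (case drift d S k x y of
        None \<Rightarrow> False
      | Some (x', y', a, b) \<Rightarrow> x' = x \<and> y' = y \<and> (quad_norm d a \<noteq> 0 \<or> quad_norm d b \<noteq> 0) \<and>
          quad_orbit d S k (x, y, a, b) = Some (x, y, a, b))"

section \<open>Soundness of the arithmetic in the quadratic field\<close>

context
  fixes d :: rat and r :: complex
  assumes r: "r * r = of_rat d"
begin

lemma quad_val_simps:
  "quad_val r (quad_add z z') = quad_val r z + quad_val r z'"
  "quad_val r (quad_diff z z') = quad_val r z - quad_val r z'"
  "quad_val r (quad_mult d z z') = quad_val r z * quad_val r z'"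
  "quad_val r (quad_if b z) = of_bool b * quad_val r z"
  "quad_val r (1, 0) = 1"
  by (simp_all add: quad_val_def quad_add_def quad_diff_def quad_mult_def quad_if_def
      of_rat_add of_rat_diff of_rat_mult r[symmetric] algebra_simps)

lemma quad_val_norm: "quad_val r (fst z, - snd z) * quad_val r z = of_rat (quad_norm d z)"
  by (simp add: quad_val_def quad_norm_def of_rat_diff of_rat_mult of_rat_minus r[symmetric] algebra_simps)

lemma quad_val_nonzero: "quad_norm d z \<noteq> 0 \<Longrightarrow> quad_val r z \<noteq> 0"
  using quad_val_norm[of z] by auto

lemma quad_val_inverse:
  assumes "quad_norm d z \<noteq> 0"
  shows "quad_val r (quad_inverse d z) = inverse (quad_val r z)"
proof -
  have "quad_val r (quad_inverse d z) = quad_val r (fst z, - snd z) / of_rat (quad_norm d z)"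
    by (simp add: quad_val_def quad_inverse_def of_rat_divide of_rat_minus diff_divide_distrib)
  also have "\<dots> = inverse (quad_val r z)"
    using quad_val_norm[of z] quad_val_nonzero[OF assms] assms by (simp add: field_simps)
  finally show ?thesis .
qed

lemma quad_val_laurent:
  assumes "quad_norm d z \<noteq> 0"
  shows "quad_val r (quad_laurent d P z) = laurent P (quad_val r z)"
  by (simp add: quad_laurent_def laurent_def quad_val_simps quad_val_inverse assms)

lemma quad_val_euler:
  assumes "quad_norm d z \<noteq> 0"
  shows "quad_val r (quad_euler d P z) = euler P (quad_val r z)"
  by (simp add: quad_euler_def euler_def quad_val_simps quad_val_inverse assms)

lemma quad_regular_val:
  assumes "quad_regular d P Q x y"
  shows "quad_val r x \<noteq> 0" "quad_val r y \<noteq> 0"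
    "laurent P (quad_val r y) \<noteq> 0" "laurent Q (quad_val r y) \<noteq> 0"
  using assms quad_val_nonzero unfolding quad_regular_def by (metis quad_val_laurent)+

lemma quad_val_ratio:
  assumes "quad_regular d P Q x y"
  shows "quad_val r (quad_mult d (quad_inverse d x) (quad_ratio d P Q y)) =
      inverse (quad_val r x) * (laurent P (quad_val r y) * inverse (laurent Q (quad_val r y)))"
    "quad_val r (quad_log_diff d P y) = euler P (quad_val r y) * inverse (laurent P (quad_val r y))"
    "quad_val r (quad_log_diff d Q y) = euler Q (quad_val r y) * inverse (laurent Q (quad_val r y))"
  using assms unfolding quad_regular_def quad_ratio_def quad_log_diff_def
  by (simp_all add: quad_val_simps quad_val_inverse quad_val_laurent quad_val_euler)

fun state_val :: "quad state \<Rightarrow> complex state" where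
  "state_val (x, y, u, w) = (quad_val r x, quad_val r y, quad_val r u, quad_val r w)"

lemma quad_phi_val:
  assumes "quad_phi d S z = Some z'"
  shows "phi_regular S (state_val z) \<and> phi_step S (state_val z) = state_val z'"
proof -
  obtain x y u w where z: "z = (x, y, u, w)" by (metis prod_cases4)
  have reg: "quad_regular d (col S (-1)) (col S 1) x y"
    using assms unfolding z by (simp split: if_splits)
  show ?thesis
    using assms quad_regular_val[OF reg] unfolding z
    by (auto simp: reg quad_val_simps(2,3) quad_val_simps(3) quad_val_ratio[OF reg, unfolded quad_val_simps])
qed

lemma quad_psi_val:
  assumes "quad_psi d S z = Some z'"
  shows "psi_regular S (state_val z) \<and> psi_step S (state_val z) = state_val z'"
proof -
  obtain x y u w where z: "z = (x, y, u, w)" by (metis prod_cases4)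
  have reg: "quad_regular d (row S (-1)) (row S 1) y x"
    using assms unfolding z by (simp split: if_splits)
  show ?thesis
    using assms quad_regular_val[OF reg] unfolding z
    by (auto simp: reg quad_val_simps(2,3) quad_val_simps(3) quad_val_ratio[OF reg, unfolded quad_val_simps])
qed

text \<open>A computation that ends in \<open>Some\<close> has met no pole, so it delivers the orbit
  of the complex state together with regularity at each of its points.\<close>

lemma quad_orbit_val:
  assumes "quad_orbit d S k z = Some z'"
  shows "(theta S ^^ k) (state_val z) = state_val z' \<and>
    (\<forall>i<k. theta_regular S ((theta S ^^ i) (state_val z)))"
  using assms
proof (induction k arbitrary: z)
  case (Suc k)
  then obtain z1 z2 where z: "quad_phi d S z = Some z1" "quad_psi d S z1 = Some z2"
    "quad_orbit d S k z2 = Some z'"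
    by (auto simp: bind_eq_Some_conv)
  have 1: "theta S (state_val z) = state_val z2" "theta_regular S (state_val z)"
    using quad_phi_val[OF z(1)] quad_psi_val[OF z(2)] by (simp_all add: theta_def theta_regular_def)
  have "theta_regular S ((theta S ^^ i) (state_val z))" if "i < Suc k" for i
    using that 1 Suc.IH[OF z(3)] by (cases i) (simp_all add: funpow_swap1)
  then show ?case
    using 1 Suc.IH[OF z(3)] by (simp add: funpow_swap1)
qed simp

end

text \<open>The root of \<open>d\<close> is taken in the complex numbers because many of the cycles
  lie at non-real points, with negative \<open>d\<close>. The initial tangent vector is (1,
  1).\<close>

lemma infinite_if_unipotent_cycle:
  assumes S: "four_sided S" and cyc: "unipotent_cycle d S k x y"
  shows "infinite (carrier (walk_group S))"
proof -
  define r where "r = csqrt (of_rat d)"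
  have r: "r * r = of_rat d"
    by (simp add: r_def flip: power2_eq_square)
  obtain u w where z: "quad_orbit d S k (x, y, (1, 0), (1, 0)) = Some (x, y, u, w)"
    and ab: "quad_norm d (quad_diff u (1, 0)) \<noteq> 0 \<or> quad_norm d (quad_diff w (1, 0)) \<noteq> 0"
    and z': "quad_orbit d S k (x, y, quad_diff u (1, 0), quad_diff w (1, 0)) =
      Some (x, y, quad_diff u (1, 0), quad_diff w (1, 0))"
    and k: "k > 0"
    using cyc unfolding unipotent_cycle_def drift_def by (auto split: option.splits)
  have "quad_val r u - 1 \<noteq> 0 \<or> quad_val r w - 1 \<noteq> 0"
    using ab quad_val_nonzero[OF r] quad_val_simps(2,5)[OF r] by metis
  then show ?thesis
    using quad_orbit_val[OF r z] quad_orbit_val[OF r z'] k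
    by (intro infinite_walk_group[OF S, of k "quad_val r x" "quad_val r y" 1 1
          "quad_val r u - 1" "quad_val r w - 1"])
      (auto simp: quad_val_simps[OF r] state_val.simps[OF r])
qed

text \<open>
  An entry \<open>(xs, d, k, a, b, y)\<close> stands for the point \<open>(a + b \<surd>d, y)\<close>. It was found by first
  searching for \<open>t\<close> such that the \<open>k\<close>-th iterate is the identity on the curve \<open>S(x, y) = t\<close>, and
  then solving this quadratic equation in \<open>x\<close> for small rational \<open>y\<close>.
\<close>

definition cert_table :: "((int \<times> int) list \<times> rat \<times> nat \<times> rat \<times> rat \<times> rat) list" where
  "cert_table = [
   ([(-1, 1), (0, 1), (1, -1)], -3, 2, -1/2, -1/2, -1),
   ([(-1, 1), (1, -1), (1, 1)], -2, 2, 0, -1/2, -1),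
   ([(-1, -1), (-1, 0), (0, -1), (1, 1)], -1, 2, -1, -1, -1/2),
   ([(-1, -1), (-1, 0), (0, 1), (1, -1)], 2, 3, -1, -1, -2),
   ([(-1, -1), (-1, 0), (0, 1), (1, 0)], -1, 4, 1/2, 1/2, -2),
   ([(-1, -1), (-1, 0), (1, -1), (1, 1)], 5, 2, 0, -1/5, -2),
   ([(-1, -1), (-1, 1), (0, 1), (1, -1)], -7, 2, -1/2, -1/2, -1),
   ([(-1, -1), (-1, 1), (0, 1), (1, 0)], 2, 3, 0, 1, -1),
   ([(-1, -1), (-1, 1), (1, 0), (1, 1)], 5, 2, 0, 1, -1/2),
   ([(-1, -1), (0, 1), (1, 0), (1, 1)], -1, 2, -1/2, -1/2, -2),
   ([(-1, 0), (-1, 1), (0, -1), (1, 0)], -1, 4, 1/2, 1/2, -1/2),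
   ([(-1, 0), (-1, 1), (0, -1), (1, 1)], 2, 3, -1, -1, -1/2),
   ([(-1, 0), (-1, 1), (0, 1), (1, -1)], -1, 2, -1, -1, -2),
   ([(-1, 0), (-1, 1), (1, -1), (1, 1)], 5, 2, 0, -1/5, -1/2),
   ([(-1, 0), (0, -1), (0, 1), (1, 1)], 5, 4, -3/2, 1/2, 1),
   ([(-1, 0), (0, 1), (1, -1), (1, 0)], -1, 4, 1, 1, -2),
   ([(-1, 0), (0, 1), (1, -1), (1, 1)], 2, 3, 0, -1/2, -1),
   ([(-1, 1), (0, 1), (1, -1), (1, 0)], 2, 2, 2, 2, -2),
   ([(-1, 1), (0, 1), (1, -1), (1, 1)], -7, 2, -1/4, -1/4, -1),
   ([(-1, -1), (-1, 0), (-1, 1), (0, -1), (1, 0)], 5, 3, -1/2, 1/2, -1),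
   ([(-1, -1), (-1, 0), (-1, 1), (0, -1), (1, 1)], -2, 2, -1, -1, -1/2),
   ([(-1, -1), (-1, 0), (-1, 1), (0, 1), (1, -1)], -2, 2, -1, -1, -2),
   ([(-1, -1), (-1, 0), (-1, 1), (0, 1), (1, 0)], 5, 3, -1/2, 1/2, -1),
   ([(-1, -1), (-1, 0), (-1, 1), (1, -1), (1, 0)], 3, 2, 0, 1, -2),
   ([(-1, -1), (-1, 0), (-1, 1), (1, 0), (1, 1)], 3, 2, 0, 1, -1/2),
   ([(-1, -1), (-1, 0), (0, -1), (0, 1), (1, 0)], -7, 3, -1/4, 1/4, -2),
   ([(-1, -1), (-1, 0), (0, -1), (0, 1), (1, 1)], 2, 5, -2, 1, 1),
   ([(-1, -1), (-1, 0), (0, 1), (1, -1), (1, 1)], -3, 3, -1/2, 1/2, 1),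
   ([(-1, -1), (-1, 0), (0, 1), (1, 0), (1, 1)], 2, 5, 0, -1/2, -2),
   ([(-1, -1), (-1, 0), (1, -1), (1, 0), (1, 1)], 3, 2, 0, -1/3, -2),
   ([(-1, -1), (-1, 1), (0, 1), (1, -1), (1, 0)], -3, 3, -1/2, 1/2, 1),
   ([(-1, -1), (-1, 1), (0, 1), (1, 0), (1, 1)], 6, 3, 1, 1, -1/3),
   ([(-1, 0), (-1, 1), (0, -1), (0, 1), (1, -1)], 2, 5, -2, 1, 1),
   ([(-1, 0), (-1, 1), (0, -1), (0, 1), (1, 0)], -7, 3, -1/4, 1/4, -1/2),
   ([(-1, 0), (-1, 1), (0, -1), (0, 1), (1, 1)], 5, 3, -1/2, -1/2, -1/2),
   ([(-1, 0), (-1, 1), (0, -1), (1, -1), (1, 1)], -3, 3, -1/2, 1/2, 1),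
   ([(-1, 0), (-1, 1), (0, 1), (1, -1), (1, 0)], 2, 5, 0, 1, -2),
   ([(-1, 0), (-1, 1), (0, 1), (1, -1), (1, 1)], 6, 3, -1/5, -1/5, -1/3),
   ([(-1, 0), (-1, 1), (1, -1), (1, 0), (1, 1)], 3, 2, 0, -1/3, -1/2),
   ([(-1, 0), (0, -1), (0, 1), (1, 0), (1, 1)], -7, 3, -1/2, 1/2, -1/2),
   ([(-1, 0), (0, 1), (1, -1), (1, 0), (1, 1)], 5, 3, 1/2, -1/2, -1),
   ([(-1, 1), (0, 1), (1, -1), (1, 0), (1, 1)], -2, 2, -2/3, -2/3, -2),
   ([(-1, -1), (-1, 0), (-1, 1), (0, -1), (0, 1), (1, -1)], -3, 2, -3/2, 1/2, 1),
   ([(-1, -1), (-1, 0), (-1, 1), (0, -1), (0, 1), (1, 1)], -3, 2, -3/2, 1/2, 1),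
   ([(-1, -1), (-1, 0), (-1, 1), (0, -1), (1, -1), (1, 1)], -7, 3, -1/4, -1/4, -1),
   ([(-1, -1), (-1, 0), (-1, 1), (0, -1), (1, 0), (1, 1)], 3, 4, 0, 1, -1/2),
   ([(-1, -1), (-1, 0), (-1, 1), (0, 1), (1, -1), (1, 0)], 3, 4, 0, 1, -2),
   ([(-1, -1), (-1, 0), (-1, 1), (0, 1), (1, -1), (1, 1)], -7, 3, -1/4, -1/4, -1),
   ([(-1, -1), (-1, 0), (-1, 1), (0, 1), (1, 0), (1, 1)], -2, 3, -1, -1/2, -2),
   ([(-1, -1), (-1, 0), (0, 1), (1, -1), (1, 0), (1, 1)], 3, 4, 0, -1/3, -2),
   ([(-1, -1), (-1, 1), (0, 1), (1, -1), (1, 0), (1, 1)], -7, 3, -1/2, -1/2, -1),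
   ([(-1, 0), (-1, 1), (0, -1), (0, 1), (1, -1), (1, 1)], 5, 2, -1/2, -3/10, -1/3),
   ([(-1, 0), (-1, 1), (0, 1), (1, -1), (1, 0), (1, 1)], -2, 3, -2/3, -1/3, -2),
   ([(-1, -1), (-1, 0), (-1, 1), (0, -1), (0, 1), (1, -1), (1, 0)], -2, 3, -1, 1/2, 1),
   ([(-1, -1), (-1, 0), (-1, 1), (0, -1), (0, 1), (1, 0), (1, 1)], -2, 3, -1, 1/2, 1),
   ([(-1, 0), (-1, 1), (0, -1), (0, 1), (1, -1), (1, 0), (1, 1)], -2, 3, -2/3, 1/3, 1)]"

text \<open>\<open>eval_nat_numeral\<close> rewrites the period to successors, on which the
  recursion of \<open>quad_orbit\<close> unfolds.\<close>

lemmas quad_eval = quad_add_def quad_diff_def quad_mult_def quad_norm_def quad_inverse_def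
  quad_if_def quad_laurent_def quad_euler_def quad_ratio_def quad_log_diff_def quad_regular_def
  col_def row_def unipotent_cycle_def drift_def eval_nat_numeral

lemma cert_table_unipotent_cycle:
  "list_all (\<lambda>(xs, d, k, a, b, y). unipotent_cycle d (set xs) k (a, b) (y, 0)) cert_table"
  unfolding cert_table_def by (simp add: quad_eval)

section \<open>Exchanging the coordinates\<close>

definition rm_swap :: ratmap where
  "rm_swap = (y_rf, x_rf)"

lemma dominant_rm_swap: "dominant rm_swap"
proof (rule dominantI[of "{}" "{}"])
  fix a b :: complex
  show "\<exists>X Y. fval X Y (fst rm_swap) (fps_const a) \<and> fval X Y (snd rm_swap) (fps_const b)"
    using fval_x fval_y unfolding rm_swap_def by fastforce
qed simp_all

lemma rm_comp_rm_swap [simp]: "rm_comp rm_swap m = prod.swap m"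
  by (simp add: rm_comp_def rm_swap_def rf_subst_x rf_subst_y prod.swap_def)

lemma rm_swap_in_Bir: "rm_swap \<in> carrier Bir"
proof -
  have "rm_comp rm_swap rm_swap = rm_id"
    unfolding rm_comp_rm_swap by (simp add: rm_swap_def rm_id_def)
  then have "birational rm_swap"
    unfolding birational_def using dominant_rm_swap by blast
  then show ?thesis
    by (simp add: Bir_def)
qed

lemma four_sided_swap: "four_sided S \<Longrightarrow> four_sided (prod.swap ` S)"
  unfolding four_sided_def small_steps_def col_def row_def by fastforce

lemma col_swap [simp]: "col (prod.swap ` S) = row S" "row (prod.swap ` S) = col S"
  by (force simp: col_def row_def fun_eq_iff)+

lemma rm_swap_conj:
  assumes S: "four_sided S"
  shows "Phi (prod.swap ` S) = rm_comp rm_swap (rm_comp (Psi S) rm_swap)"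
    and "Psi (prod.swap ` S) = rm_comp rm_swap (rm_comp (Phi S) rm_swap)"
  unfolding rm_comp_rm_swap Phi_comp[OF S dominant_rm_swap] Psi_comp[OF S dominant_rm_swap]
    Phi_eq[OF four_sided_swap[OF S]] Psi_eq[OF four_sided_swap[OF S]]
  by (simp_all add: rm_swap_def)

lemma (in group) generate_conj_involution:
  assumes t: "t \<in> carrier G" "t \<otimes> t = \<one>" and A: "A \<subseteq> carrier G"
  shows "bij_betw (\<lambda>g. t \<otimes> (g \<otimes> t)) (generate G A) (generate G ((\<lambda>g. t \<otimes> (g \<otimes> t)) ` A))"
proof -
  let ?f = "\<lambda>g. t \<otimes> (g \<otimes> t)"
  have tt: "t \<otimes> (t \<otimes> g) = g" if "g \<in> carrier G" for g
    using t that by (simp flip: m_assoc)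
  have "?f \<in> hom G G"
    using t tt by (intro homI) (simp_all add: m_assoc)
  then have "group_hom G G ?f"
    by unfold_locales
  then have "generate G (?f ` A) = ?f ` generate G A"
    using A by (intro group_hom.generate_img)
  moreover have "inj_on ?f (generate G A)"
  proof (rule inj_onI)
    fix x y assume "x \<in> generate G A" "y \<in> generate G A" and eq: "?f x = ?f y"
    then have xy: "x \<in> carrier G" "y \<in> carrier G"
      using generate_incl[OF A] by auto
    have "x \<otimes> t = y \<otimes> t"
      using arg_cong[OF eq, of "\<lambda>g. t \<otimes> g"] t(1) xy by (simp only: tt m_closed)
    then show "x = y"
      using t(1) xy by simp
  qed
  ultimately show ?thesis
    by (simp add: bij_betw_def)
qed

text \<open>Conjugation by \<open>rm_swap\<close> carries \<Phi> of a step set to \<Psi> of its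
  mirror image and conversely, hence one group bijectively onto the other.\<close>

lemma walk_group_swap:
  assumes S: "four_sided S"
  shows "card (carrier (walk_group (prod.swap ` S))) = card (carrier (walk_group S))"
    and "finite (carrier (walk_group (prod.swap ` S))) = finite (carrier (walk_group S))"
proof -
  interpret Bir: group Bir by (rule group_Bir)
  have "rm_swap \<otimes>\<^bsub>Bir\<^esub> rm_swap = \<one>\<^bsub>Bir\<^esub>"
    unfolding Bir_simps rm_comp_rm_swap by (simp add: rm_swap_def rm_id_def)
  then have "bij_betw (\<lambda>g. rm_swap \<otimes>\<^bsub>Bir\<^esub> (g \<otimes>\<^bsub>Bir\<^esub> rm_swap)) (generate Bir {Psi S, Phi S})
      (generate Bir ((\<lambda>g. rm_swap \<otimes>\<^bsub>Bir\<^esub> (g \<otimes>\<^bsub>Bir\<^esub> rm_swap)) ` {Psi S, Phi S}))"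
    using in_carrier_Bir[OF S] rm_swap_in_Bir by (intro Bir.generate_conj_involution) simp_all
  moreover have "(\<lambda>g. rm_swap \<otimes>\<^bsub>Bir\<^esub> (g \<otimes>\<^bsub>Bir\<^esub> rm_swap)) ` {Psi S, Phi S} =
      {Psi (prod.swap ` S), Phi (prod.swap ` S)}"
    by (simp add: rm_swap_conj[OF S] insert_commute del: rm_comp_rm_swap)
  ultimately have "bij_betw (\<lambda>g. rm_swap \<otimes>\<^bsub>Bir\<^esub> (g \<otimes>\<^bsub>Bir\<^esub> rm_swap))
      (carrier (walk_group S)) (carrier (walk_group (prod.swap ` S)))"
    using carrier_walk_group S four_sided_swap[OF S] by simp
  then show "card (carrier (walk_group (prod.swap ` S))) = card (carrier (walk_group S))"
    "finite (carrier (walk_group (prod.swap ` S))) = finite (carrier (walk_group S))"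
    by (simp_all add: bij_betw_same_card bij_betw_finite)
qed

section \<open>The finite groups\<close>

lemma fval_point_eq:
  assumes "f = g" "fval X Y f F" "fval X Y g G"
  shows "F $ 0 = G $ 0"
  using assms fval_unique by blast

text \<open>At 1 both Laurent polynomials take values between 1 and 3. The factor 100 arises as the
  square of the coordinate 10 in the point used to separate \<Phi> and \<Psi> from the
  identity.\<close>

lemma laurent_1_ne:
  assumes "\<exists>i\<in>{-1, 0, 1}. P i" "\<exists>i\<in>{-1, 0, 1}. Q i"
  shows "laurent P 1 \<noteq> 100 * (laurent Q 1 :: complex)"
  using assms by (auto simp: laurent_def of_bool_def)

lemma involutions_ne_id:
  assumes S: "four_sided S"
  shows "Phi S \<noteq> rm_id" "Psi S \<noteq> rm_id"
proof -
  note cases = four_sided_cases[OF S]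
  have key: "1 / f * (laurent P g / laurent Q g) \<noteq> f"
    if "fval X Y f (fps_const 10)" "fval X Y g (fps_const 1)" "f \<noteq> 0" "laurent Q g \<noteq> 0"
      "\<exists>i\<in>{-1, 0, 1}. P i" "\<exists>i\<in>{-1, 0, 1}. Q i" for f g :: ratfun and P Q X Y
  proof
    assume "1 / f * (laurent P g / laurent Q g) = f"
    then have eq: "laurent P g = f * f * laurent Q g"
      using that(3,4) by (simp add: field_simps)
    have val: "fval X Y (laurent R g) (laurent R (fps_const 1))" for R
      by (rule fval_laurent[OF that(2)]) simp
    have "laurent P (fps_const 1 :: complex fps) $ 0 =
        (fps_const 10 * fps_const 10 * laurent Q (fps_const 1)) $ 0"
      by (rule fval_point_eq[OF eq val fval_mult[OF fval_mult[OF that(1,1)] val]])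
    then have "laurent P 1 = 100 * (laurent Q 1 :: complex)"
      by (simp add: fps_mult_nth laurent_fps_nth_0)
    then show False
      using laurent_1_ne that(5,6) by blast
  qed
  show "Phi S \<noteq> rm_id"
    using key[OF fval_x[of "fps_const 10" "fps_const 1"] fval_y] cases laurent_nonzero
    unfolding Phi_eq[OF S] rm_id_def by auto
  show "Psi S \<noteq> rm_id"
    using key[OF fval_y[of "fps_const 1" "fps_const 10"] fval_x] cases laurent_nonzero
    unfolding Psi_eq[OF S] rm_id_def by auto
qed

lemma dominant_theta: "four_sided S \<Longrightarrow> dominant (rm_comp (Psi S) (Phi S))"
  by (simp add: dominant_Phi dominant_Psi dominant_rm_comp)

text \<open>Otherwise \<Phi> = \<Psi>. As \<Phi> fixes \<open>y\<close> and \<Psi> fixes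
  \<open>x\<close>, this common map would be the identity.\<close>

lemma theta_ne_id:
  assumes S: "four_sided S"
  shows "rm_comp (Psi S) (Phi S) \<noteq> rm_id"
proof
  assume id: "rm_comp (Psi S) (Phi S) = rm_id"
  have "snd (rm_comp (Psi S) (rm_comp (Psi S) (Phi S))) = snd (Phi S)"
    using rm_comp_assoc[OF dominant_Psi[OF S] dominant_Phi[OF S], of "Psi S"] S
    by (simp add: Psi_involution)
  then have "snd (Psi S) = y_rf"
    by (simp only: id rm_comp_id_right) (simp add: Phi_def)
  then have "Psi S = rm_id"
    by (simp add: Psi_def rm_id_def)
  then show False
    using involutions_ne_id[OF S] by simp
qed

lemma card_walk_group:
  assumes S: "four_sided S" and ord: "2 \<le> group.ord Bir (rm_comp (Psi S) (Phi S))"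
  shows "card (carrier (walk_group S)) = 2 * group.ord Bir (rm_comp (Psi S) (Phi S))"
  using group.card_generate_involutions[OF group_Bir in_carrier_Bir(2,1)[OF S]] ord
  by (simp add: carrier_walk_group S Phi_involution Psi_involution involutions_ne_id)

section \<open>Order 4 from a vertical symmetry\<close>

lemma card_walk_group_vertical:
  assumes S: "four_sided S" and sym: "vertical_symmetry S"
  shows "card (carrier (walk_group S)) = 4"
proof -
  interpret Bir: group Bir by (rule group_Bir)
  have mem: "(- i, j) \<in> S \<longleftrightarrow> (i, j) \<in> S" for i j
    using sym unfolding vertical_symmetry_def
    by (metis (no_types, lifting) case_prod_conv image_eqI minus_minus)
  have col: "col S (-1) = col S 1"
    using mem[of 1] by (simp add: col_def)
  \<comment> \<open>Each row of steps is symmetric, so \<open>A_j\<close> is invariant under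
    \<open>x\<close> to \<open>1/x\<close>.\<close>
  have row: "laurent (row S j) (1 / f) = laurent (row S j) f" for j and f :: ratfun
    using mem[of 1 j] by (simp add: laurent_def row_def inverse_eq_divide)
  let ?r = "laurent (row S (-1)) x_rf / laurent (row S 1) x_rf"
  have Phi: "Phi S = (1 / x_rf, y_rf)"
    using laurent_nonzero four_sided_cases[OF S] by (simp add: Phi_eq[OF S] col)
  have theta: "rm_comp (Psi S) (Phi S) = (1 / x_rf, 1 / y_rf * ?r)"
    unfolding Psi_comp[OF S dominant_Phi[OF S]] unfolding Phi by (simp add: row)
  have r: "?r \<noteq> 0"
    using laurent_nonzero four_sided_cases[OF S] by simp
  have "rm_comp (rm_comp (Psi S) (Phi S)) (rm_comp (Psi S) (Phi S)) = rm_id"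
    using r dominant_theta[OF S] unfolding rm_comp_def[of "rm_comp (Psi S) (Phi S)"]
    by (simp add: theta rf_subst_hom rf_subst_laurent row rm_id_def)
  moreover have carr: "rm_comp (Psi S) (Phi S) \<in> carrier Bir"
    using Bir.m_closed in_carrier_Bir[OF S] by fastforce
  ultimately have "Bir.ord (rm_comp (Psi S) (Phi S)) dvd 2"
    using Bir.pow_eq_id[OF carr, of 2] by (simp add: numeral_2_eq_2)
  moreover have "Bir.ord (rm_comp (Psi S) (Phi S)) \<noteq> 1"
    using theta_ne_id[OF S] Bir.ord_eq_1[OF carr] by simp
  ultimately have "Bir.ord (rm_comp (Psi S) (Phi S)) = 2"
    using prime_nat_iff two_is_prime_nat by blast
  then show ?thesis
    using card_walk_group[OF S] by simp
qed

text \<open>The relations \<open>B_{-1} = y^b B_1\<close> and \<open>A_{-1} = x^c A_1\<close>,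
  expressed by translations of finite sets of steps so that they can be decided by
  evaluation.\<close>

definition monomial_model :: "step_set \<Rightarrow> int \<Rightarrow> int \<Rightarrow> bool" where
  "monomial_model S b c \<longleftrightarrow>
     {p \<in> S. fst p = -1} = (\<lambda>p. (-1, snd p + b)) ` {p \<in> S. fst p = 1} \<and>
     {p \<in> S. snd p = -1} = (\<lambda>p. (fst p + c, -1)) ` {p \<in> S. snd p = 1}"

lemma laurent_shift:
  fixes f :: "'a::field"
  assumes "Collect P = (\<lambda>i. i + b) ` Collect Q" "Collect P \<subseteq> {-1, 0, 1}" "Collect Q \<subseteq> {-1, 0, 1}" "f \<noteq> 0"
  shows "laurent P f = f powi b * laurent Q f"
proof -
  have "laurent P f = (\<Sum>i\<in>(\<lambda>i. i + b) ` Collect Q. f powi i)"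
    using laurent_powi[OF assms(2), of f] assms(1) by simp
  also have "\<dots> = (\<Sum>i\<in>Collect Q. f powi (i + b))"
    by (subst sum.reindex) (auto simp: inj_on_def)
  also have "\<dots> = f powi b * laurent Q f"
    using assms(4) by (simp add: power_int_add laurent_powi[OF assms(3), symmetric]
        sum_distrib_left mult.commute)
  finally show ?thesis .
qed

lemma monomial_model_Phi_Psi:
  assumes S: "four_sided S" and "monomial_model S b c"
  shows "Phi S = (y_rf powi b / x_rf, y_rf)" "Psi S = (x_rf, x_rf powi c / y_rf)"
proof -
  have small: "S \<subseteq> small_steps"
    using S by (simp add: four_sided_def)
  have sub: "Collect (col S i) \<subseteq> {-1, 0, 1}" "Collect (row S i) \<subseteq> {-1, 0, 1}" for i
    using small by (auto simp: col_def row_def small_steps_def)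
  have "Collect (col S (-1)) = snd ` {p \<in> S. fst p = -1}" "Collect (col S 1) = snd ` {p \<in> S. fst p = 1}"
    "Collect (row S (-1)) = fst ` {p \<in> S. snd p = -1}" "Collect (row S 1) = fst ` {p \<in> S. snd p = 1}"
    by (force simp: col_def row_def)+
  then have shift: "Collect (col S (-1)) = (\<lambda>i. i + b) ` Collect (col S 1)"
    "Collect (row S (-1)) = (\<lambda>i. i + c) ` Collect (row S 1)"
    using assms(2) by (simp_all add: monomial_model_def image_image)
  have "laurent (col S (-1)) y_rf = y_rf powi b * laurent (col S 1) y_rf"
    "laurent (row S (-1)) x_rf = x_rf powi c * laurent (row S 1) x_rf"
    using laurent_shift[OF shift(1) sub(1) sub(1) xy_nonzero(2)]
      laurent_shift[OF shift(2) sub(2) sub(2) xy_nonzero(1)] by simp_all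
  then show "Phi S = (y_rf powi b / x_rf, y_rf)" "Psi S = (x_rf, x_rf powi c / y_rf)"
    using laurent_nonzero four_sided_cases[OF S] by (simp_all add: Phi_eq[OF S] Psi_eq[OF S])
qed

lemma rm_comp_theta_monomial:
  assumes S: "four_sided S" "monomial_model S b c" and m: "dominant m"
  shows "rm_comp (rm_comp (Psi S) (Phi S)) m =
    (snd m powi b / fst m, (snd m powi b / fst m) powi c / snd m)"
proof -
  have "rm_comp (rm_comp (Psi S) (Phi S)) m = rm_comp (Psi S) (rm_comp (Phi S) m)"
    using m S by (simp add: rm_comp_assoc dominant_Phi)
  moreover have "rm_comp (Phi S) m = (snd m powi b / fst m, snd m)"
    unfolding monomial_model_Phi_Psi[OF S] rm_comp_def by (simp add: rf_subst_hom m)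
  moreover have "dominant (rm_comp (Phi S) m)"
    using m S by (simp add: dominant_Phi dominant_rm_comp)
  ultimately show ?thesis
    unfolding monomial_model_Phi_Psi[OF S] rm_comp_def[of "(x_rf, _)"] by (simp add: rf_subst_hom)
qed

text \<open>On exponents \<Theta> acts by the matrix with rows \<open>(-1, b)\<close> and
  \<open>(-c, b c - 1)\<close>, of determinant 1 and trace \<open>b c - 2\<close>. Trace -1 means
  order 3; trace 0 means that the square is -1, hence order 4.\<close>

lemma card_walk_group_monomial:
  assumes S: "four_sided S" "monomial_model S b c"
  shows "(b, c) \<in> {(1, 1), (-1, -1)} \<Longrightarrow> card (carrier (walk_group S)) = 6"
    and "(b, c) \<in> {(1, 2), (2, 1), (-1, -2), (-2, -1)} \<Longrightarrow> card (carrier (walk_group S)) = 8"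
proof -
  interpret Bir: group Bir by (rule group_Bir)
  let ?t = "rm_comp (Psi S) (Phi S)"
  have carr: "?t \<in> carrier Bir"
    using Bir.m_closed in_carrier_Bir[OF S(1)] by fastforce
  have Suc: "?t [^]\<^bsub>Bir\<^esub> Suc n = rm_comp ?t (?t [^]\<^bsub>Bir\<^esub> n)" for n
    using Bir.nat_pow_Suc2[OF carr] by simp
  have t1: "?t [^]\<^bsub>Bir\<^esub> Suc 0 = (y_rf powi b / x_rf, (y_rf powi b / x_rf) powi c / y_rf)"
    unfolding Suc using rm_comp_theta_monomial[OF S dominant_rm_id] by (simp add: rm_id_def)
  have t: "?t [^]\<^bsub>Bir\<^esub> Suc n = (g powi b / f, (g powi b / f) powi c / g)"
    if "?t [^]\<^bsub>Bir\<^esub> n = (f, g)" for n f g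
  proof -
    have "dominant (f, g)"
      using dominant_Bir[OF Bir.nat_pow_closed[OF carr, of n]] unfolding that .
    then show ?thesis
      unfolding Suc that using rm_comp_theta_monomial[OF S] by simp
  qed
  {
    assume "(b, c) \<in> {(1, 1), (-1, -1)}"
    then have "?t [^]\<^bsub>Bir\<^esub> (3::nat) = rm_id"
      using t[OF t[OF t1]] by (auto simp: numeral_3_eq_3 rm_id_def field_simps power_int_minus
          power2_eq_square simp del: Bir.nat_pow_Suc)
    then have "Bir.ord ?t dvd 3"
      using Bir.pow_eq_id[OF carr, of 3] by simp
    moreover have "Bir.ord ?t \<noteq> 1"
      using theta_ne_id[OF S(1)] Bir.ord_eq_1[OF carr] by simp
    moreover have "prime (3::nat)"
      by simp
    ultimately have "Bir.ord ?t = 3"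
      unfolding prime_nat_iff by blast
    then show "card (carrier (walk_group S)) = 6"
      using card_walk_group[OF S(1)] by simp
  }
  {
    assume "(b, c) \<in> {(1, 2), (2, 1), (-1, -2), (-2, -1)}"
    then have t2: "?t [^]\<^bsub>Bir\<^esub> Suc (Suc 0) = (1 / x_rf, 1 / y_rf)"
      using t[OF t1] by (auto simp: field_simps power_int_minus
          power2_eq_square simp del: Bir.nat_pow_Suc)
    have "?t [^]\<^bsub>Bir\<^esub> (4::nat) = (?t [^]\<^bsub>Bir\<^esub> (2::nat)) \<otimes>\<^bsub>Bir\<^esub> (?t [^]\<^bsub>Bir\<^esub> (2::nat))"
      using carr by (simp add: Bir.nat_pow_mult del: Bir_simps)
    moreover have "dominant (1 / x_rf, 1 / y_rf)"
      using dominant_Bir[OF Bir.nat_pow_closed[OF carr]] t2 by metis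
    ultimately have "?t [^]\<^bsub>Bir\<^esub> (4::nat) = rm_id"
      using t2 by (simp add: numeral_2_eq_2 rm_comp_def rf_subst_hom rm_id_def del: Bir.nat_pow_Suc)
    then have 4: "Bir.ord ?t dvd 2 ^ 2"
      using Bir.pow_eq_id[OF carr, of 4] by simp
    have "1 / x_rf \<noteq> x_rf"
    proof
      assume "1 / x_rf = x_rf"
      then have "const_rf 1 = x_rf * x_rf"
        by (simp add: field_simps)
      \<comment> \<open>Evaluation at \<open>x = 2\<close> would give 1 = 4.\<close>
      then have "fps_const 1 $ 0 = (fps_const 2 * fps_const (2::complex)) $ 0"
        using fval_point_eq fval_const[of "fps_const 2" 1]
          fval_mult[OF fval_x fval_x, of "fps_const 2" 1] by blast
      then show False by simp
    qed
    then have "?t [^]\<^bsub>Bir\<^esub> (2::nat) \<noteq> \<one>\<^bsub>Bir\<^esub>"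
      using t2 by (simp add: numeral_2_eq_2 rm_id_def del: Bir.nat_pow_Suc)
    then have "\<not> Bir.ord ?t dvd 2 ^ 1"
      using Bir.pow_eq_id[OF carr, of 2] by simp
    with 4 have "Bir.ord ?t = 4"
      using divides_primepow_nat[OF two_is_prime_nat, of "Bir.ord ?t" 2]
      by (auto simp: le_Suc_eq numeral_2_eq_2)
    then show "card (carrier (walk_group S)) = 8"
      using card_walk_group[OF S(1)] by simp
  }
qed

section \<open>The classification\<close>

definition all_steps :: "(int \<times> int) list" where
  "all_steps = [(-1, -1), (-1, 0), (-1, 1), (0, -1), (0, 1), (1, -1), (1, 0), (1, 1)]"

text \<open>A normal form: the fixed order of \<open>all_steps\<close> lets step sets be compared
  and looked up as lists.\<close>

definition step_list :: "step_set \<Rightarrow> (int \<times> int) list" where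
  "step_list S = filter (\<lambda>p. p \<in> S) all_steps"

text \<open>One member per class. An entry may be symmetric about the other axis, in which case its
  mirror image has the vertical symmetry.\<close>

definition reps_vertical :: "(int \<times> int) list list" where
  "reps_vertical = [
   [(-1, -1), (-1, 1), (1, 0)],
   [(-1, 0), (1, -1), (1, 1)],
   [(-1, -1), (-1, 0), (-1, 1), (1, 0)],
   [(-1, -1), (-1, 1), (1, -1), (1, 1)],
   [(-1, 0), (0, -1), (0, 1), (1, 0)],
   [(-1, 0), (1, -1), (1, 0), (1, 1)],
   [(-1, -1), (-1, 0), (-1, 1), (1, -1), (1, 1)],
   [(-1, -1), (-1, 0), (0, 1), (1, -1), (1, 0)],
   [(-1, -1), (-1, 1), (0, 1), (1, -1), (1, 1)],
   [(-1, 0), (-1, 1), (0, -1), (1, 0), (1, 1)],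
   [(-1, -1), (-1, 0), (-1, 1), (0, -1), (0, 1), (1, 0)],
   [(-1, -1), (-1, 0), (-1, 1), (1, -1), (1, 0), (1, 1)],
   [(-1, 0), (-1, 1), (0, -1), (0, 1), (1, 0), (1, 1)],
   [(-1, -1), (-1, 0), (-1, 1), (0, -1), (0, 1), (1, -1), (1, 1)],
   [(-1, -1), (-1, 0), (-1, 1), (0, 1), (1, -1), (1, 0), (1, 1)],
   [(-1, -1), (-1, 0), (-1, 1), (0, -1), (0, 1), (1, -1), (1, 0), (1, 1)]]"

text \<open>Tandem and double tandem steps, followed by Kreweras, reverse Kreweras and double
  Kreweras steps.\<close>

definition reps_order_6 :: "(int \<times> int) list list" where
  "reps_order_6 = [
   [(-1, 0), (0, 1), (1, -1)],
   [(-1, 0), (-1, 1), (0, -1), (0, 1), (1, -1), (1, 0)],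
   [(-1, 0), (0, -1), (1, 1)],
   [(-1, -1), (0, 1), (1, 0)],
   [(-1, -1), (-1, 0), (0, -1), (0, 1), (1, 0), (1, 1)]]"

text \<open>Gessel steps and Gouyou-Beauchamps steps.\<close>

definition reps_order_8 :: "(int \<times> int) list list" where
  "reps_order_8 = [
   [(-1, -1), (-1, 0), (1, 0), (1, 1)],
   [(-1, 0), (-1, 1), (1, -1), (1, 0)]]"

definition reps_infinite :: "(int \<times> int) list list" where
  "reps_infinite = map fst cert_table"

definition reps :: "(int \<times> int) list list" where
  "reps = reps_vertical @ reps_order_6 @ reps_order_8 @ reps_infinite"

lemma reps_lengths:
  "length reps_vertical = 16" "length reps_order_6 = 5" "length reps_order_8 = 2"
  "length reps_infinite = 56"
  by (simp_all add: reps_vertical_def reps_order_6_def reps_order_8_def reps_infinite_def cert_table_def)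

text \<open>Exhaustion of all 256 subsets of the eight steps. It shows both that the list misses no
  class and that it contains nothing inadmissible.\<close>

lemma admissible_reps_check:
  "list_all (\<lambda>xs. admissible (set xs) \<longleftrightarrow>
     xs \<in> set reps \<or> step_list (prod.swap ` set xs) \<in> set reps) (subseqs all_steps)"
  by code_simp

lemma distinct_reps: "distinct reps"
  by code_simp

text \<open>Entries are in normal form, and an entry whose mirror image is listed too is its own
  mirror image; hence no class is listed twice.\<close>

lemma step_list_reps_check:
  "list_all (\<lambda>xs. step_list (set xs) = xs \<and>
     (step_list (prod.swap ` set xs) \<in> set reps \<longrightarrow> step_list (prod.swap ` set xs) = xs)) reps"
  by code_simp

lemma reps_vertical_check:
  "list_all (\<lambda>xs. vertical_symmetry (set xs) \<or> vertical_symmetry (prod.swap ` set xs)) reps_vertical"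
  by code_simp

lemma reps_order_6_check:
  "list_all (\<lambda>xs. monomial_model (set xs) 1 1 \<or> monomial_model (set xs) (-1) (-1)) reps_order_6"
  by code_simp

lemma reps_order_8_check:
  "list_all (\<lambda>xs. monomial_model (set xs) 1 2 \<or> monomial_model (set xs) 2 1 \<or>
     monomial_model (set xs) (-1) (-2) \<or> monomial_model (set xs) (-2) (-1)) reps_order_8"
  by code_simp

section \<open>From the enumeration to arbitrary step sets\<close>

lemma set_all_steps: "set all_steps = small_steps"
  by code_simp

lemma set_step_list: "S \<subseteq> small_steps \<Longrightarrow> set (step_list S) = S"
  by (auto simp: step_list_def set_all_steps)

lemma filter_in_subseqs: "filter P xs \<in> set (subseqs xs)"
  by (induction xs) (auto simp: Let_def)

lemma swap_small_steps:
  assumes "S \<subseteq> small_steps"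
  shows "prod.swap ` S \<subseteq> small_steps"
proof -
  have "prod.swap ` small_steps = small_steps"
    by code_simp
  then show ?thesis
    using assms by blast
qed

lemma admissible_iff:
  assumes "S \<subseteq> small_steps"
  shows "admissible S \<longleftrightarrow> step_list S \<in> set reps \<or> step_list (prod.swap ` S) \<in> set reps"
proof -
  have "step_list S \<in> set (subseqs all_steps)"
    unfolding step_list_def by (rule filter_in_subseqs)
  from bspec[OF admissible_reps_check[unfolded list_all_iff] this] show ?thesis
    by (simp only: set_step_list[OF assms])
qed

lemma admissible_small_steps: "admissible S \<Longrightarrow> S \<subseteq> small_steps"
  by (simp add: admissible_def)

text \<open>The criterion obtained from the enumeration is symmetric in a step set and its mirror
  image.\<close>

lemma admissible_swap: "admissible S \<Longrightarrow> admissible (prod.swap ` S)"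
  using admissible_iff[of S] admissible_iff[of "prod.swap ` S"] swap_small_steps[of S]
    admissible_small_steps[of S]
  by (auto simp: image_image)

lemma four_sided_if_admissible:
  assumes "admissible S"
  shows "four_sided S"
proof -
  have small: "S \<subseteq> small_steps"
    using assms by (rule admissible_small_steps)
  have bounds: "(0 < i \<longrightarrow> i = 1) \<and> (i < 0 \<longrightarrow> i = -1) \<and> (0 < j \<longrightarrow> j = 1) \<and> (j < 0 \<longrightarrow> j = -1)"
    if "(i, j) \<in> S" for i j
    using subsetD[OF small that] by (simp add: small_steps_def) linarith
  have "\<exists>p\<in>S. 0 < fst p" "\<exists>p\<in>S. fst p < 0" "\<exists>p\<in>S. 0 < snd p" "\<exists>p\<in>S. snd p < 0"
    using assms by (simp_all add: admissible_def case_prod_unfold)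
  then obtain p q p' q' where "p \<in> S" "0 < fst p" "q \<in> S" "fst q < 0"
    "p' \<in> S" "0 < snd p'" "q' \<in> S" "snd q' < 0"
    by blast
  then have "(1, snd p) \<in> S" "(-1, snd q) \<in> S" "(fst p', 1) \<in> S" "(fst q', -1) \<in> S"
    using bounds by (metis prod.collapse)+
  then show ?thesis
    using small unfolding four_sided_def col_def row_def by (intro conjI exI)
qed

section \<open>Models counted by their representatives\<close>

definition model_of :: "step_set \<Rightarrow> step_set set" where
  "model_of S = {S, prod.swap ` S}"

lemma reps_admissible:
  assumes "xs \<in> set reps"
  shows "admissible (set xs)"
proof -
  have xs: "step_list (set xs) = xs"
    using step_list_reps_check assms by (simp add: list_all_iff)
  then have "set xs \<subseteq> small_steps"
    by (metis filter_is_subset set_all_steps step_list_def)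
  then show ?thesis
    using admissible_iff xs assms by simp
qed

lemma models_eq: "models = (\<lambda>xs. model_of (set xs)) ` set reps"
proof -
  have "diagonal_reflection `` {S} = model_of S" if "admissible S" for S
    using that admissible_swap[OF that] by (auto simp: diagonal_reflection_def model_of_def)
  then have 1: "models = model_of ` {S. admissible S}"
    by (auto simp: models_def quotient_def)
  have "model_of S \<in> (\<lambda>xs. model_of (set xs)) ` set reps" if "admissible S" for S
  proof -
    have small: "S \<subseteq> small_steps"
      using that by (rule admissible_small_steps)
    have "model_of (prod.swap ` S) = model_of S"
      by (auto simp: model_of_def image_image)
    then show ?thesis
      using that admissible_iff[OF small] set_step_list[OF small]
        set_step_list[OF swap_small_steps[OF small]] by (metis image_eqI)
  qed
  then show ?thesis
    unfolding 1 using reps_admissible by auto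
qed

lemma inj_on_model_of: "inj_on (\<lambda>xs. model_of (set xs)) (set reps)"
proof (rule inj_onI)
  fix xs ys assume xy: "xs \<in> set reps" "ys \<in> set reps" and eq: "model_of (set xs) = model_of (set ys)"
  have norm: "step_list (set xs) = xs" "step_list (set ys) = ys"
    "step_list (prod.swap ` set ys) \<in> set reps \<Longrightarrow> step_list (prod.swap ` set ys) = ys"
    using step_list_reps_check xy by (simp_all add: list_all_iff)
  from eq have "set xs = set ys \<or> set xs = prod.swap ` set ys"
    unfolding model_of_def by blast
  then show "xs = ys"
    using norm xy by metis
qed

lemma card_models_filter:
  "card {c \<in> models. Q c} = card {xs \<in> set reps. Q (model_of (set xs))}"
proof -
  have "{c \<in> models. Q c} = (\<lambda>xs. model_of (set xs)) ` {xs \<in> set reps. Q (model_of (set xs))}"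
    by (auto simp: models_eq)
  then show ?thesis
    by (simp add: card_image inj_on_subset[OF inj_on_model_of])
qed

lemma all_model_of_card:
  assumes "xs \<in> set reps" "S \<in> model_of (set xs)"
  shows "card (carrier (walk_group S)) = card (carrier (walk_group (set xs)))"
    "finite (carrier (walk_group S)) = finite (carrier (walk_group (set xs)))"
  using assms walk_group_swap[OF four_sided_if_admissible[OF reps_admissible]]
  by (auto simp: model_of_def)

lemma reps_vertical_card:
  assumes "xs \<in> set reps" "S \<in> model_of (set xs)" "vertical_symmetry S"
  shows "card (carrier (walk_group (set xs))) = 4"
proof -
  have "admissible S"
    using assms reps_admissible admissible_swap by (auto simp: model_of_def)
  then have "card (carrier (walk_group S)) = 4"
    using assms by (intro card_walk_group_vertical four_sided_if_admissible)
  then show ?thesis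
    using all_model_of_card(1)[OF assms(1,2)] by simp
qed

lemma reps_card:
  "xs \<in> set reps_vertical \<Longrightarrow> \<exists>S\<in>model_of (set xs). vertical_symmetry S"
  "xs \<in> set reps_order_6 \<Longrightarrow> card (carrier (walk_group (set xs))) = 6"
  "xs \<in> set reps_order_8 \<Longrightarrow> card (carrier (walk_group (set xs))) = 8"
  "xs \<in> set reps_infinite \<Longrightarrow> infinite (carrier (walk_group (set xs)))"
proof -
  have four: "four_sided (set xs)" if "xs \<in> set reps" for xs
    using that by (intro four_sided_if_admissible reps_admissible)
  show "\<exists>S\<in>model_of (set xs). vertical_symmetry S" if "xs \<in> set reps_vertical"
    using that reps_vertical_check by (auto simp: list_all_iff model_of_def)
  show "card (carrier (walk_group (set xs))) = 6" if xs: "xs \<in> set reps_order_6"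
  proof -
    have "xs \<in> set reps"
      using xs by (simp add: reps_def)
    moreover have "monomial_model (set xs) 1 1 \<or> monomial_model (set xs) (-1) (-1)"
      using xs reps_order_6_check by (simp add: list_all_iff)
    ultimately show ?thesis
      using card_walk_group_monomial(1)[OF four, of xs] by blast
  qed
  show "card (carrier (walk_group (set xs))) = 8" if xs: "xs \<in> set reps_order_8"
  proof -
    have "xs \<in> set reps"
      using xs by (simp add: reps_def)
    moreover have "monomial_model (set xs) 1 2 \<or> monomial_model (set xs) 2 1 \<or>
        monomial_model (set xs) (-1) (-2) \<or> monomial_model (set xs) (-2) (-1)"
      using xs reps_order_8_check by (simp add: list_all_iff)
    ultimately show ?thesis
      using card_walk_group_monomial(2)[OF four, of xs] by blast
  qed
  show "infinite (carrier (walk_group (set xs)))" if xs: "xs \<in> set reps_infinite"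
  proof -
    obtain d k a b y where "(xs, d, k, a, b, y) \<in> set cert_table"
      using xs by (auto simp: reps_infinite_def)
    then have "unipotent_cycle d (set xs) k (a, b) (y, 0)"
      using cert_table_unipotent_cycle by (auto simp: list_all_iff)
    moreover have "four_sided (set xs)"
      using xs by (intro four) (simp add: reps_def)
    ultimately show ?thesis
      by (intro infinite_if_unipotent_cycle)
  qed
qed

theorem theorem3:
  shows
    "card models = 79 \<and>
     card {c \<in> models. \<forall>S\<in>c. finite (carrier (walk_group S))} = 23 \<and>
     card {c \<in> models. \<exists>S\<in>c. vertical_symmetry S} = 16 \<and>
     (\<forall>c\<in>models. (\<exists>S\<in>c. vertical_symmetry S) \<longrightarrow>
        (\<forall>S\<in>c. card (carrier (walk_group S)) = 4)) \<and>
     card {c \<in> models. \<forall>S\<in>c. card (carrier (walk_group S)) = 6} = 5 \<and>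
     card {c \<in> models. \<forall>S\<in>c. card (carrier (walk_group S)) = 8} = 2 \<and>
     card {c \<in> models. \<forall>S\<in>c. infinite (carrier (walk_group S))} = 56"
proof -
  let ?n = "\<lambda>xs. card (carrier (walk_group (set xs)))"
  let ?fin = "\<lambda>xs. finite (carrier (walk_group (set xs)))"
  let ?vert = "\<lambda>xs. \<exists>S\<in>model_of (set xs). vertical_symmetry S"
  have all: "(\<forall>S\<in>model_of (set xs). P S) \<longleftrightarrow> P (set xs)"
    if "\<And>S. S \<in> model_of (set xs) \<Longrightarrow> P S \<longleftrightarrow> P (set xs)" for P xs
  proof
    assume "\<forall>S\<in>model_of (set xs). P S"
    then show "P (set xs)"
      by (simp add: model_of_def)
  next
    assume "P (set xs)"
    then show "\<forall>S\<in>model_of (set xs). P S"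
      using that by blast
  qed
  have all_card: "(\<forall>S\<in>model_of (set xs). card (carrier (walk_group S)) = n) \<longleftrightarrow> ?n xs = n"
    and all_fin: "(\<forall>S\<in>model_of (set xs). finite (carrier (walk_group S))) \<longleftrightarrow> ?fin xs"
    and all_inf: "(\<forall>S\<in>model_of (set xs). infinite (carrier (walk_group S))) \<longleftrightarrow> \<not> ?fin xs"
    if "xs \<in> set reps" for xs n
    by (rule all, simp add: all_model_of_card[OF that])+
  have vert: "?vert xs \<Longrightarrow> ?n xs = 4" if "xs \<in> set reps" for xs
    using reps_vertical_card that by blast
  \<comment> \<open>Vertical symmetry forces order 4, so the orders 6 and 8 exclude it; so does an
    infinite group, whose \<open>card\<close> is 0 by convention. The four kinds are thus mutually
    exclusive, and each list consists of exactly the representatives with its property.\<close>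
  have kinds: "xs \<in> set reps_vertical \<and> ?vert xs \<and> ?n xs = 4 \<and> ?fin xs \<or>
      xs \<in> set reps_order_6 \<and> \<not> ?vert xs \<and> ?n xs = 6 \<and> ?fin xs \<or>
      xs \<in> set reps_order_8 \<and> \<not> ?vert xs \<and> ?n xs = 8 \<and> ?fin xs \<or>
      xs \<in> set reps_infinite \<and> \<not> ?vert xs \<and> ?n xs = 0 \<and> \<not> ?fin xs"
    if xs: "xs \<in> set reps" for xs
  proof -
    have fin: "?n xs \<noteq> 0 \<Longrightarrow> ?fin xs"
      by (rule ccontr) simp
    have "xs \<in> set reps_vertical \<or> xs \<in> set reps_order_6 \<or> xs \<in> set reps_order_8 \<or> xs \<in> set reps_infinite"
      using xs by (simp add: reps_def)
    then show ?thesis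
    proof (elim disjE)
      assume "xs \<in> set reps_vertical"
      moreover from this have "?vert xs"
        by (rule reps_card(1))
      moreover from this have "?n xs = 4"
        by (rule vert[OF xs])
      moreover from this have "?fin xs"
        using fin by linarith
      ultimately show ?thesis
        by (intro disjI1 conjI)
    next
      assume "xs \<in> set reps_order_6"
      moreover from this have "?n xs = 6"
        by (rule reps_card(2))
      moreover from this have "\<not> ?vert xs" "?fin xs"
        using vert[OF xs] fin by linarith+
      ultimately show ?thesis
        by (intro disjI2[OF disjI1] conjI)
    next
      assume "xs \<in> set reps_order_8"
      moreover from this have "?n xs = 8"
        by (rule reps_card(3))
      moreover from this have "\<not> ?vert xs" "?fin xs"
        using vert[OF xs] fin by linarith+
      ultimately show ?thesis
        by (intro disjI2[OF disjI2[OF disjI1]] conjI)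
    next
      assume "xs \<in> set reps_infinite"
      moreover from this have "\<not> ?fin xs"
        by (rule reps_card(4))
      moreover from this have "?n xs = 0"
        by (rule card.infinite)
      moreover from this have "\<not> ?vert xs"
        using vert[OF xs] by linarith
      ultimately show ?thesis
        by (intro disjI2[OF disjI2[OF disjI2]] conjI)
    qed
  qed
  have sub: "set reps_vertical \<subseteq> set reps" "set reps_order_6 \<subseteq> set reps"
    "set reps_order_8 \<subseteq> set reps" "set reps_infinite \<subseteq> set reps"
    by (auto simp: reps_def)
  have disj: "distinct reps_vertical" "distinct reps_order_6" "distinct reps_order_8"
    "distinct reps_infinite"
    using distinct_reps by (auto simp: reps_def)
  have "card models = card (set reps)"
    using card_models_filter[of "\<lambda>_. True"] by simp
  also have "\<dots> = 79"
    using distinct_card[OF distinct_reps] by (simp add: reps_def reps_lengths)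
  finally have 1: "card models = 79" .
  have kind_iff: "xs \<in> set reps_vertical \<longleftrightarrow> ?vert xs" "xs \<in> set reps_order_6 \<longleftrightarrow> ?n xs = 6"
    "xs \<in> set reps_order_8 \<longleftrightarrow> ?n xs = 8" "xs \<in> set reps_infinite \<longleftrightarrow> \<not> ?fin xs"
    if "xs \<in> set reps" for xs
    using kinds[OF that] reps_card[of xs] by auto
  have "{xs \<in> set reps. ?vert xs} = set reps_vertical"
    using kind_iff(1) sub(1) by blast
  then have 3: "card {xs \<in> set reps. ?vert xs} = 16"
    using distinct_card[OF disj(1)] by (simp add: reps_lengths)
  have "{xs \<in> set reps. ?n xs = 6} = set reps_order_6"
    using kind_iff(2) sub(2) by blast
  then have 4: "card {xs \<in> set reps. ?n xs = 6} = 5"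
    using distinct_card[OF disj(2)] by (simp add: reps_lengths)
  have "{xs \<in> set reps. ?n xs = 8} = set reps_order_8"
    using kind_iff(3) sub(3) by blast
  then have 5: "card {xs \<in> set reps. ?n xs = 8} = 2"
    using distinct_card[OF disj(3)] by (simp add: reps_lengths)
  have inf: "{xs \<in> set reps. \<not> ?fin xs} = set reps_infinite"
    using kind_iff(4) sub(4) by blast
  then have 6: "card {xs \<in> set reps. \<not> ?fin xs} = 56"
    using distinct_card[OF disj(4)] by (simp add: reps_lengths)
  have "{xs \<in> set reps. ?fin xs} = set reps - set reps_infinite"
    using inf by blast
  then have 2: "card {xs \<in> set reps. ?fin xs} = 23"
    using card_Diff_subset[OF _ sub(4)] distinct_card[OF distinct_reps] distinct_card[OF disj(4)]
    by (simp add: reps_lengths reps_def)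
  have "\<forall>c\<in>models. (\<exists>S\<in>c. vertical_symmetry S) \<longrightarrow> (\<forall>S\<in>c. card (carrier (walk_group S)) = 4)"
    using vert all_card unfolding models_eq by blast
  then show ?thesis
    unfolding card_models_filter using 1 2 3 4 5 6 by (simp add: all_card all_fin all_inf cong: conj_cong)
qed

end
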